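(* Fix $t\ge0$. Let $U\in C^\alpha$ on $[0,t]$ with $\alpha\in(1/3,1/2]$ and $U_0=0$, and let $z=x+iy\in\mathbb{H}$. Let $\beta_s=U_t-U_{t-s}$, $0\le s\le t$, and let $X,Y,G$ be as defined in the context. Then $$\log|f_t'(z+U_t)|=M_t-\int_0^t\dot G_r^2\,dr+\log\Bigl(\frac{Y_t}{y}\Bigr)-\log\Bigl(\frac{X_t^2+Y_t^2}{x^2+y^2}\Bigr),$$ where $M_t$ is given as the rough integral $$M_t=\lim_n\sum_{[u,v]\in\pi_n}\Bigl(\dot G_u(\beta_v-\beta_u)+\dot G'_u\,\tfrac12(\beta_v-\beta_u)^2\Bigr)$$ with the Gubinelli derivative $$\dot G'_s:=\dot Y_s/Y_s-\dot G_s^2 .$$ If in addition $U$ (equivalently: $\beta$) has continuous finite quadratic variation in the sense of F\"ollmer (along $\pi$), then $$\log|f_t'(z+U_t)|=M^\pi_t+\frac12\int_0^t\dot G'_s\,d[\beta]^\pi_s-\int_0^t\dot G_r^2\,dr+\log\Bigl(\frac{Y_t}{y}\Bigr)-\log\Bigl(\frac{X_t^2+Y_t^2}{x^2+y^2}\Bigr)$$ with the (deterministic) F\"ollmer--It\^o integral $$M^\pi_t=\lim_n\sum_{[u,v]\in\pi_n}\dot G_u(\beta_v-\beta_u)=:\int_0^t\dot G\,d^\pi\beta .$$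
   Context: $\mathbb{H}$ is the open complex upper half-plane, and $C^\alpha$ denotes the space of $\alpha$-H\"older continuous real-valued paths. For a continuous driver $U$ with $U_0=0$ and $z\in\overline{\mathbb{H}}\setminus\{0\}$, $g_s(z)$ denotes the solution of Loewner's differential equation $\dot g_s(z)=\frac{2}{g_s(z)-U_s}$, $g_0(z)=z$ (up to its lifetime), and $f_s=g_s^{-1}$, a conformal map defined on $\mathbb{H}$. $(X_s,Y_s)_{s\in[0,t]}$ is the solution of $$dX_s=d\beta_s-\frac{2X_s}{X_s^2+Y_s^2}ds,\quad X_0=x,\qquad dY_s=\frac{2Y_s}{X_s^2+Y_s^2}ds,\quad Y_0=y$$ (understood in integrated form), and $G_s:=\beta_s-X_s$, a $C^1$ function with $\dot G_s=\frac{2X_s}{X_s^2+Y_s^2}$. $\pi=(\pi_n)$ is a fixed sequence of partitions, with mesh-size going to zero, of the time interval (here $[0,t]$). A path $V$ on this interval has continuous finite quadratic variation in the sense of F\"ollmer (along $\pi$) if for every $s$ in the interval the limit $[V]^\pi_s:=\lim_{n\to\infty}\sum_{[u,v]\in\pi_n}(V_{v\wedge s}-V_{u\wedge s})^2$ exists and $s\mapsto[V]^\pi_s$ is continuous.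
   Formalization: The second formula assumes that β has continuous finite quadratic variation along π; the stated equivalence with U is false along the same non-symmetric π, so it is proved for U along the time-reversed partitions t−π_n (equal to π_n when these are symmetric). *)

theory Defs
  imports "HOL-Analysis.Analysis"
begin

definition hoelder_on :: "real \<Rightarrow> real set \<Rightarrow> (real \<Rightarrow> real) \<Rightarrow> bool" where
  "hoelder_on \<alpha> S f \<longleftrightarrow>
     (\<exists>C. \<forall>r\<in>S. \<forall>s\<in>S. \<bar>f r - f s\<bar> \<le> C * \<bar>r - s\<bar> powr \<alpha>)"


subsection \<open>The Loewner flow\<close>

text \<open>A solution on the closed interval from 0 to \<open>s\<close> that avoids the driver up to and including
  time \<open>s\<close> exists precisely if the lifetime of the starting point is greater than \<open>s\<close>. At the
  end points of the interval the derivative is one-sided.\<close>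

definition loewner_solution :: "(real \<Rightarrow> real) \<Rightarrow> complex \<Rightarrow> real \<Rightarrow> (real \<Rightarrow> complex) \<Rightarrow> bool" where
  "loewner_solution U z s \<gamma> \<longleftrightarrow>
     \<gamma> 0 = z \<and>
     (\<forall>r\<in>{0..s}. \<gamma> r \<noteq> of_real (U r) \<and>
        (\<gamma> has_vector_derivative 2 / (\<gamma> r - of_real (U r))) (at r within {0..s}))"

definition loewner_domain :: "(real \<Rightarrow> real) \<Rightarrow> real \<Rightarrow> complex set" where
  "loewner_domain U s = {z. 0 \<le> Im z \<and> z \<noteq> 0 \<and> (\<exists>\<gamma>. loewner_solution U z s \<gamma>)}"

definition loewner_flow :: "(real \<Rightarrow> real) \<Rightarrow> real \<Rightarrow> complex \<Rightarrow> complex" where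
  "loewner_flow U s z = (THE w. \<exists>\<gamma>. loewner_solution U z s \<gamma> \<and> w = \<gamma> s)"

definition loewner_inverse :: "(real \<Rightarrow> real) \<Rightarrow> real \<Rightarrow> complex \<Rightarrow> complex" where
  "loewner_inverse U s = the_inv_into (loewner_domain U s) (loewner_flow U s)"

text \<open>The integral equations force \<open>X\<close> and \<open>Y\<close> to be continuous (for continuous \<open>\<beta>\<close>), and for
  \<open>y > 0\<close> they force \<open>Y \<ge> y\<close>, so that the denominators never vanish.\<close>

definition backward_solution ::
  "real \<Rightarrow> (real \<Rightarrow> real) \<Rightarrow> real \<Rightarrow> real \<Rightarrow> (real \<Rightarrow> real) \<Rightarrow> (real \<Rightarrow> real) \<Rightarrow> bool" where
  "backward_solution t \<beta> x y X Y \<longleftrightarrow>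
     (\<forall>s\<in>{0..t}.
        (\<lambda>r. 2 * X r / ((X r)\<^sup>2 + (Y r)\<^sup>2)) integrable_on {0..s} \<and>
        (\<lambda>r. 2 * Y r / ((X r)\<^sup>2 + (Y r)\<^sup>2)) integrable_on {0..s} \<and>
        X s = x + (\<beta> s - \<beta> 0) - integral {0..s} (\<lambda>r. 2 * X r / ((X r)\<^sup>2 + (Y r)\<^sup>2)) \<and>
        Y s = y + integral {0..s} (\<lambda>r. 2 * Y r / ((X r)\<^sup>2 + (Y r)\<^sup>2)))"


subsection \<open>Partitions and pathwise quadratic variation\<close>

text \<open>A partition is the set of its closed intervals \<open>k\<close>, with end points \<open>Inf k\<close> and \<open>Sup k\<close>.
  One-point intervals are permitted; they contribute 0 to every sum below and allow \<open>t = 0\<close>.\<close>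

definition partition_sequence :: "real \<Rightarrow> (nat \<Rightarrow> real set set) \<Rightarrow> bool" where
  "partition_sequence t \<pi> \<longleftrightarrow>
     (\<forall>n. \<pi> n division_of {0..t}) \<and> (\<lambda>n. MAX k\<in>\<pi> n. Sup k - Inf k) \<longlonglongrightarrow> 0"

definition reversed_partitions :: "real \<Rightarrow> (nat \<Rightarrow> real set set) \<Rightarrow> nat \<Rightarrow> real set set" where
  "reversed_partitions t \<pi> n = (\<lambda>k. (\<lambda>r. t - r) ` k) ` \<pi> n"

definition quad_var_sum :: "(nat \<Rightarrow> real set set) \<Rightarrow> (real \<Rightarrow> real) \<Rightarrow> real \<Rightarrow> nat \<Rightarrow> real" where
  "quad_var_sum \<pi> V s n = (\<Sum>k\<in>\<pi> n. (V (min (Sup k) s) - V (min (Inf k) s))\<^sup>2)"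

definition quad_var :: "(nat \<Rightarrow> real set set) \<Rightarrow> (real \<Rightarrow> real) \<Rightarrow> real \<Rightarrow> real" where
  "quad_var \<pi> V s = lim (quad_var_sum \<pi> V s)"

definition has_cont_quad_var :: "real \<Rightarrow> (nat \<Rightarrow> real set set) \<Rightarrow> (real \<Rightarrow> real) \<Rightarrow> bool" where
  "has_cont_quad_var t \<pi> V \<longleftrightarrow>
     (\<forall>s\<in>{0..t}. convergent (quad_var_sum \<pi> V s)) \<and> continuous_on {0..t} (quad_var \<pi> V)"

text \<open>Lebesgue--Stieltjes integral over \<open>{0..t}\<close>. The integrator is extended by constants outside
  \<open>{0..t}\<close>, since \<open>interval_measure\<close> expects a function that is nondecreasing and right-continuous
  on the whole line; for continuous integrators neither end point carries mass.\<close>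

definition stieltjes_integral :: "real \<Rightarrow> (real \<Rightarrow> real) \<Rightarrow> (real \<Rightarrow> real) \<Rightarrow> real" where
  "stieltjes_integral t h F = (LINT r:{0..t}|interval_measure (\<lambda>s. F (max 0 (min t s))). h r)"

end

theory Submission
  imports Defs
begin

text \<open>
  Put \<open>Z = X + i * Y\<close>. The system for \<open>X\<close> and \<open>Y\<close> says that \<open>Z s = z + \<beta> s - \<integral>\<^sub>0\<^sup>s 2 / Z\<close>, and
  \<open>r \<mapsto> Z (t - r) + U r\<close> is the Loewner trajectory that ends at \<open>z + U t\<close>. The difference of two Loewner
  trajectories solves a linear differential equation (\<open>loewner_difference\<close>). Solving it explicitly
  yields the difference quotients of \<open>f\<^sub>t\<close>, and in the limit
  \<open>f\<^sub>t' (z + U t) = exp (\<integral>\<^sub>0\<^sup>t 2 / Z\<^sup>2)\<close> (\<open>loewner_inverse_has_field_derivative\<close>). That trajectories through all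
  nearby end points exist is a Picard iteration (\<open>loewner_backward_exists\<close>). Hence the left-hand side of
  the claim is \<open>\<integral>\<^sub>0\<^sup>t Re (2 / Z\<^sup>2)\<close>.

  The integrands are \<open>dG = Re (2 / Z)\<close> and \<open>dG' = - Re (2 / Z\<^sup>2)\<close>, the real parts of the first two
  derivatives of \<open>2 * Ln\<close> at \<open>Z\<close>. Expanding \<open>2 * Ln Z\<close> to second order shows that each summand of
  the rough integral equals the increment of \<open>\<Psi> s = 2 * ln \<bar>Z s\<bar> + \<integral>\<^sub>0\<^sup>s Re (4 / Z\<^sup>2)\<close> up to an error
  \<open>O((v - u) powr (3 * \<alpha>))\<close> (\<open>log_germ_estimate\<close>). Since \<open>3 * \<alpha> > 1\<close>, the errors sum to 0 in the limit,
  so the rough sums converge to \<open>M = \<Psi> t - \<Psi> 0\<close> (\<open>sum_germ_tendsto_increment\<close>). The first formula is then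
  the pointwise identity \<open>Re (2 / p\<^sup>2) = Re (4 / p\<^sup>2) - (Re (2 / p))\<^sup>2 + 2 / \<bar>p\<bar>\<^sup>2\<close>, integrated along \<open>Z\<close>,
  together with \<open>ln (Y t / y) = \<integral>\<^sub>0\<^sup>t 2 / \<bar>Z\<bar>\<^sup>2\<close> (\<open>log_derivative_identity\<close>).

  If \<open>\<beta>\<close> has continuous quadratic variation, sums of squared increments weighted by the continuous
  function \<open>dG'\<close> converge to the Stieltjes integral (\<open>weighted_sq_sum_tendsto_integral\<close>), so the first-order
  sums converge on their own. Both this and the invariance of quadratic variation under time reversal
  (\<open>has_cont_quad_var_reversal\<close>) rest on the fact that sums of squares over adjacent time intervals add up,
  except for the cross term of the single partition interval across the common end point.
\<close>

section \<open>Riemann sums along partitions\<close>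

lemma division_of_interval_eq:
  fixes k :: "real set"
  assumes "d division_of {a..b}" "k \<in> d"
  obtains l u where "k = {l..u}" "l \<le> u" "a \<le> l" "u \<le> b"
  using division_ofD(2,3,4)[OF assms] by (auto simp: box_real)

lemma division_of_interval_bounds:
  fixes k :: "real set"
  assumes "d division_of {a..b}" "k \<in> d"
  shows "Inf k \<le> Sup k" "a \<le> Inf k" "Sup k \<le> b"
proof -
  obtain l u where "k = {l..u}" "l \<le> u" "a \<le> l" "u \<le> b"
    using division_of_interval_eq[OF assms] .
  then show "Inf k \<le> Sup k" "a \<le> Inf k" "Sup k \<le> b" by simp_all
qed

lemma division_telescope:
  fixes f :: "real \<Rightarrow> real"
  assumes "d division_of {a..b}" "a \<le> b"
  shows "(\<Sum>k\<in>d. f (Sup k) - f (Inf k)) = f b - f a"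
proof -
  let ?f = "(\<lambda>K::real set. if K = {} then 0 else f (Sup K) - f (Inf K))"
  interpret operative_real plus 0 ?f
    rewrites "comm_monoid_set.F (+) 0 = sum"
    by standard[1] (auto simp add: sum_def)
  have d: "d division_of {a..b}" using assms by simp
  have "sum ?f d = ?f {a..b}" using division[OF d] .
  moreover have "sum ?f d = (\<Sum>k\<in>d. f (Sup k) - f (Inf k))"
    by (rule sum.cong) (use division_ofD(3)[OF d] in auto)
  ultimately show ?thesis using \<open>a \<le> b\<close> by simp
qed

definition mesh :: "real set set \<Rightarrow> real" where
  "mesh d = (MAX k\<in>d. Sup k - Inf k)"

lemma length_le_mesh:
  assumes "d division_of {a..b}" "k \<in> d"
  shows "Sup k - Inf k \<le> mesh d"
  unfolding mesh_def using assms division_of_finite[OF assms(1)] by (intro Max_ge) auto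

lemma partition_sequenceD:
  assumes "partition_sequence t \<pi>"
  shows "\<pi> n division_of {0..t}" "(\<lambda>n. mesh (\<pi> n)) \<longlonglongrightarrow> 0"
  using assms unfolding partition_sequence_def mesh_def by auto

text \<open>One factor \<open>Sup k - Inf k\<close> sums to \<open>t\<close>; the remaining power \<open>\<gamma> - 1\<close> is at most a power of the mesh.\<close>

lemma sum_superlinear_tendsto_0:
  assumes \<pi>: "partition_sequence t \<pi>" and "0 \<le> t" and \<gamma>: "1 < \<gamma>"
  shows "(\<lambda>n. \<Sum>k\<in>\<pi> n. (Sup k - Inf k) powr \<gamma>) \<longlonglongrightarrow> 0"
proof (rule Lim_null_comparison)
  note D = partition_sequenceD[OF \<pi>]
  show "(\<lambda>n. max 0 (mesh (\<pi> n)) powr (\<gamma> - 1) * t) \<longlonglongrightarrow> 0"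
  proof -
    have "(\<lambda>n. max 0 (mesh (\<pi> n))) \<longlonglongrightarrow> max 0 0" by (intro tendsto_intros D)
    then have "(\<lambda>n. max 0 (mesh (\<pi> n)) powr (\<gamma> - 1)) \<longlonglongrightarrow> 0"
      using \<gamma> by (intro tendsto_zero_powrI[where b = "\<gamma> - 1"]) auto
    then show ?thesis by (rule tendsto_mult_left_zero)
  qed
  show "\<forall>\<^sub>F n in sequentially. norm (\<Sum>k\<in>\<pi> n. (Sup k - Inf k) powr \<gamma>)
      \<le> max 0 (mesh (\<pi> n)) powr (\<gamma> - 1) * t"
  proof (rule always_eventually, rule allI)
    fix n
    have "(Sup k - Inf k) powr \<gamma> \<le> max 0 (mesh (\<pi> n)) powr (\<gamma> - 1) * (Sup k - Inf k)"
      if k: "k \<in> \<pi> n" for k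
    proof -
      let ?l = "Sup k - Inf k"
      have l: "0 \<le> ?l" "?l \<le> max 0 (mesh (\<pi> n))"
        using division_of_interval_bounds[OF D(1) k] length_le_mesh[OF D(1) k] by auto
      have "?l powr \<gamma> = ?l powr (\<gamma> - 1) * ?l"
        using l by (cases "?l = 0") (auto simp: powr_mult_base powr_add[symmetric] powr_diff)
      also have "\<dots> \<le> max 0 (mesh (\<pi> n)) powr (\<gamma> - 1) * ?l"
        using l \<gamma> by (intro mult_right_mono powr_mono2) auto
      finally show ?thesis .
    qed
    then have "(\<Sum>k\<in>\<pi> n. (Sup k - Inf k) powr \<gamma>)
        \<le> (\<Sum>k\<in>\<pi> n. max 0 (mesh (\<pi> n)) powr (\<gamma> - 1) * (Sup k - Inf k))"
      by (rule sum_mono)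
    also have "\<dots> = max 0 (mesh (\<pi> n)) powr (\<gamma> - 1) * t"
      using division_telescope[OF D(1) \<open>0 \<le> t\<close>, where f = "\<lambda>x. x"] by (simp add: sum_distrib_left[symmetric])
    finally show "norm (\<Sum>k\<in>\<pi> n. (Sup k - Inf k) powr \<gamma>)
      \<le> max 0 (mesh (\<pi> n)) powr (\<gamma> - 1) * t"
      by (simp add: sum_nonneg)
  qed
qed

text \<open>The part of the sewing lemma that is needed when the limit is known in advance: a germ that differs
  from the increments of \<open>\<Psi>\<close> by a superlinear error has Riemann sums that converge to the total
  increment of \<open>\<Psi>\<close>.\<close>

lemma sum_germ_tendsto_increment:
  fixes \<Psi> :: "real \<Rightarrow> real"
  assumes \<pi>: "partition_sequence t \<pi>" and "0 \<le> t" and \<gamma>: "1 < \<gamma>"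
    and germ: "\<And>u v. 0 \<le> u \<Longrightarrow> u \<le> v \<Longrightarrow> v \<le> t \<Longrightarrow>
          \<bar>\<Xi> u v - (\<Psi> v - \<Psi> u)\<bar> \<le> C * (v - u) powr \<gamma>"
  shows "(\<lambda>n. \<Sum>k\<in>\<pi> n. \<Xi> (Inf k) (Sup k)) \<longlonglongrightarrow> \<Psi> t - \<Psi> 0"
proof (rule Lim_transform2[where f = "\<lambda>n. \<Sum>k\<in>\<pi> n. \<Psi> (Sup k) - \<Psi> (Inf k)"])
  note D = partition_sequenceD[OF \<pi>]
  show "(\<lambda>n. \<Sum>k\<in>\<pi> n. \<Psi> (Sup k) - \<Psi> (Inf k)) \<longlonglongrightarrow> \<Psi> t - \<Psi> 0"
    by (simp add: division_telescope[OF D(1) \<open>0 \<le> t\<close>])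
  show "(\<lambda>n. (\<Sum>k\<in>\<pi> n. \<Psi> (Sup k) - \<Psi> (Inf k)) - (\<Sum>k\<in>\<pi> n. \<Xi> (Inf k) (Sup k))) \<longlonglongrightarrow> 0"
  proof (rule Lim_null_comparison)
    show "(\<lambda>n. C * (\<Sum>k\<in>\<pi> n. (Sup k - Inf k) powr \<gamma>)) \<longlonglongrightarrow> 0"
      by (intro tendsto_mult_right_zero sum_superlinear_tendsto_0[OF \<pi>] assms)
    show "\<forall>\<^sub>F n in sequentially. norm ((\<Sum>k\<in>\<pi> n. \<Psi> (Sup k) - \<Psi> (Inf k)) -
        (\<Sum>k\<in>\<pi> n. \<Xi> (Inf k) (Sup k))) \<le> C * (\<Sum>k\<in>\<pi> n. (Sup k - Inf k) powr \<gamma>)"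
      unfolding sum_subtractf[symmetric] sum_distrib_left
    proof (intro always_eventually allI sum_norm_le)
      fix n k assume k: "k \<in> \<pi> n"
      show "norm (\<Psi> (Sup k) - \<Psi> (Inf k) - \<Xi> (Inf k) (Sup k)) \<le> C * (Sup k - Inf k) powr \<gamma>"
        using germ[of "Inf k" "Sup k"] division_of_interval_bounds[OF D(1) k] by auto
    qed
  qed
qed

section \<open>Quadratic variation along partitions\<close>

text \<open>Clamping the end points of an interval \<open>k\<close> to \<open>{a..b}\<close> turns the increment of a path over \<open>k\<close> into
  its increment over the part of \<open>k\<close> inside \<open>{a..b}\<close>. Sums localised in this way allow quadratic
  variation to be studied on subintervals whose end points are not partition points.\<close>

definition clamp_between :: "real \<Rightarrow> real \<Rightarrow> real \<Rightarrow> real" where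
  "clamp_between a b r = max a (min b r)"

definition weighted_sq_sum :: "(real \<Rightarrow> real) \<Rightarrow> (real \<Rightarrow> real) \<Rightarrow> real \<Rightarrow> real \<Rightarrow> real set set \<Rightarrow> real" where
  "weighted_sq_sum h V a b d =
     (\<Sum>k\<in>d. h (Inf k) * (V (clamp_between a b (Sup k)) - V (clamp_between a b (Inf k)))\<^sup>2)"

lemma weighted_sq_sum_full:
  assumes "d division_of {0..t}"
  shows "weighted_sq_sum h V 0 t d = (\<Sum>k\<in>d. h (Inf k) * (V (Sup k) - V (Inf k))\<^sup>2)"
  unfolding weighted_sq_sum_def
proof (rule sum.cong)
  fix k assume "k \<in> d"
  from division_of_interval_bounds[OF assms this]
  have "clamp_between 0 t (Sup k) = Sup k" "clamp_between 0 t (Inf k) = Inf k"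
    by (auto simp: clamp_between_def)
  then show "h (Inf k) * (V (clamp_between 0 t (Sup k)) - V (clamp_between 0 t (Inf k)))\<^sup>2 =
      h (Inf k) * (V (Sup k) - V (Inf k))\<^sup>2" by simp
qed simp

lemma quad_var_sum_eq_weighted_sq_sum:
  assumes "\<pi> n division_of {0..t}" "0 \<le> s"
  shows "quad_var_sum \<pi> V s n = weighted_sq_sum (\<lambda>_. 1) V 0 s (\<pi> n)"
  unfolding quad_var_sum_def weighted_sq_sum_def
proof (rule sum.cong)
  fix k assume k: "k \<in> \<pi> n"
  have "clamp_between 0 s (Sup k) = min (Sup k) s" "clamp_between 0 s (Inf k) = min (Inf k) s"
    using division_of_interval_bounds[OF assms(1) k] \<open>0 \<le> s\<close> by (auto simp: clamp_between_def)
  then show "(V (min (Sup k) s) - V (min (Inf k) s))\<^sup>2 =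
      1 * (V (clamp_between 0 s (Sup k)) - V (clamp_between 0 s (Inf k)))\<^sup>2" by simp
qed simp

text \<open>Distinct intervals of a division have disjoint interiors. This is what makes sums of squares
  asymptotically additive: only the one interval across a given point is cut there.\<close>

lemma card_straddling_le_1:
  fixes c :: real
  assumes "d division_of {a..b}"
  shows "card {k\<in>d. Inf k < c \<and> c < Sup k} \<le> 1"
proof -
  have straddle_interior: "c \<in> interior k" if k: "k \<in> d" "Inf k < c" "c < Sup k" for k
  proof -
    obtain l u where "k = {l..u}" "l \<le> u" "a \<le> l" "u \<le> b" using division_of_interval_eq[OF assms k(1)] .
    then show ?thesis using k by simp
  qed
  have "k = l" if "k \<in> d" "l \<in> d" "Inf k < c" "c < Sup k" "Inf l < c" "c < Sup l" for k l
  proof (rule ccontr)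
    assume "k \<noteq> l"
    then have "interior k \<inter> interior l = {}" using division_ofD(5)[OF assms] that by blast
    moreover have "c \<in> interior k" "c \<in> interior l"
      using that by (auto intro!: straddle_interior)
    ultimately show False by auto
  qed
  moreover have "finite d" using assms by auto
  ultimately show ?thesis by (subst card_le_Suc0_iff_eq[unfolded One_nat_def[symmetric]]) auto
qed

text \<open>Since \<open>(p + q)\<^sup>2 - p\<^sup>2 - q\<^sup>2 = 2 * p * q\<close>, cutting at \<open>c\<close> leaves only cross terms, and a cross term
  vanishes unless its interval has \<open>c\<close> in its interior. The one remaining term is at most twice the
  squared oscillation \<open>w\<close> of the path over the length of the mesh, times the bound on the weight.\<close>

lemma weighted_sq_sum_split_le:
  assumes d: "d division_of {0..t}" and abc: "0 \<le> a" "a \<le> c" "c \<le> b" "b \<le> t"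
    and H: "\<And>r. r \<in> {0..t} \<Longrightarrow> \<bar>h r\<bar> \<le> H"
    and w: "\<And>r s. r \<in> {0..t} \<Longrightarrow> s \<in> {0..t} \<Longrightarrow> \<bar>r - s\<bar> \<le> mesh d \<Longrightarrow> \<bar>V r - V s\<bar> \<le> w"
    and "0 \<le> w"
  shows "\<bar>weighted_sq_sum h V a b d - (weighted_sq_sum h V a c d + weighted_sq_sum h V c b d)\<bar>
      \<le> 2 * H * w\<^sup>2"
proof -
  define \<Delta> where "\<Delta> p q k = V (clamp_between p q (Sup k)) - V (clamp_between p q (Inf k))" for p q k
  let ?K = "{k\<in>d. Inf k < c \<and> c < Sup k}"
  have "finite d" using d by auto
  have H0: "0 \<le> H" using H[of a] abc by auto
  have add: "\<Delta> a b k = \<Delta> a c k + \<Delta> c b k" for k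
    unfolding \<Delta>_def clamp_between_def using abc by (auto simp: max_def min_def)
  have zero: "\<Delta> a c k * \<Delta> c b k = 0" if "k \<in> d - ?K" for k
  proof -
    have "Sup k \<le> c \<and> Inf k \<le> c \<or> c \<le> Sup k \<and> c \<le> Inf k"
      using that division_of_interval_bounds(1)[OF d, of k] by auto
    then show ?thesis
    proof
      assume "Sup k \<le> c \<and> Inf k \<le> c"
      then have "\<Delta> c b k = 0" using abc
        by (simp add: \<Delta>_def clamp_between_def min_absorb2 max_absorb1)
      then show ?thesis by simp
    next
      assume "c \<le> Sup k \<and> c \<le> Inf k"
      then have "\<Delta> a c k = 0" using abc
        by (simp add: \<Delta>_def clamp_between_def min_absorb1 max_absorb2)
      then show ?thesis by simp
    qed
  qed
  have bound: "\<bar>\<Delta> p q k\<bar> \<le> w" if "k \<in> d" "0 \<le> p" "p \<le> q" "q \<le> t" for p q k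
    unfolding \<Delta>_def
  proof (rule w)
    show "\<bar>clamp_between p q (Sup k) - clamp_between p q (Inf k)\<bar> \<le> mesh d"
      using length_le_mesh[OF d that(1)] division_of_interval_bounds(1)[OF d that(1)]
      unfolding clamp_between_def by linarith
  qed (use that in \<open>auto simp: clamp_between_def\<close>)
  have "weighted_sq_sum h V a b d - (weighted_sq_sum h V a c d + weighted_sq_sum h V c b d)
      = (\<Sum>k\<in>d. h (Inf k) * (2 * (\<Delta> a c k * \<Delta> c b k)))"
    unfolding weighted_sq_sum_def \<Delta>_def[symmetric] add
    by (simp add: sum.distrib[symmetric] sum_subtractf[symmetric] power2_eq_square algebra_simps)
  also have "\<dots> = (\<Sum>k\<in>?K. h (Inf k) * (2 * (\<Delta> a c k * \<Delta> c b k)))"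
    by (rule sum.mono_neutral_right) (use zero \<open>finite d\<close> in auto)
  also have "\<bar>\<dots>\<bar> \<le> real (card ?K) * (2 * H * w\<^sup>2)"
  proof (rule order_trans[OF sum_abs sum_bounded_above])
    fix k assume k: "k \<in> ?K"
    then have "k \<in> d" by simp
    have "\<bar>\<Delta> a c k\<bar> \<le> w" "\<bar>\<Delta> c b k\<bar> \<le> w"
      using abc by (auto intro!: bound[OF \<open>k \<in> d\<close>])
    then have "\<bar>\<Delta> a c k * \<Delta> c b k\<bar> \<le> w\<^sup>2"
      unfolding abs_mult power2_eq_square using \<open>0 \<le> w\<close> by (intro mult_mono) auto
    moreover have "\<bar>h (Inf k)\<bar> \<le> H"
    proof (rule H)
      show "Inf k \<in> {0..t}"
        using division_of_interval_bounds[OF d \<open>k \<in> d\<close>] by (metis atLeastAtMost_iff order_trans)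
    qed
    ultimately have "\<bar>h (Inf k)\<bar> * (2 * \<bar>\<Delta> a c k * \<Delta> c b k\<bar>) \<le> H * (2 * w\<^sup>2)"
      using H0 by (intro mult_mono) auto
    then show "\<bar>h (Inf k) * (2 * (\<Delta> a c k * \<Delta> c b k))\<bar> \<le> 2 * H * w\<^sup>2"
      by (simp add: abs_mult)
  qed
  also have "\<dots> \<le> 1 * (2 * H * w\<^sup>2)"
    using card_straddling_le_1[OF d, of c] H0 by (intro mult_right_mono) auto
  finally show ?thesis by simp
qed

text \<open>By uniform continuity of \<open>V\<close> the oscillation \<open>w\<close> above tends to 0 with the mesh.\<close>

lemma weighted_sq_sum_split_tendsto:
  assumes \<pi>: "partition_sequence t \<pi>" and abc: "0 \<le> a" "a \<le> c" "c \<le> b" "b \<le> t"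
    and V: "continuous_on {0..t} V" and h: "continuous_on {0..t} h"
  shows "(\<lambda>n. weighted_sq_sum h V a b (\<pi> n) -
      (weighted_sq_sum h V a c (\<pi> n) + weighted_sq_sum h V c b (\<pi> n))) \<longlonglongrightarrow> 0"
proof (rule tendstoI)
  fix e :: real assume e: "0 < e"
  note D = partition_sequenceD[OF \<pi>]
  obtain H where H: "0 < H" "\<And>r. r \<in> {0..t} \<Longrightarrow> \<bar>h r\<bar> \<le> H"
    using compact_imp_bounded[OF compact_continuous_image[OF h compact_Icc]]
    by (auto simp: bounded_pos)
  define w where "w = sqrt (e / (4 * H))"
  have w: "0 < w" "2 * H * w\<^sup>2 < e" using e H by (auto simp: w_def)
  obtain \<delta> where \<delta>: "\<delta> > 0" "\<And>r s. r \<in> {0..t} \<Longrightarrow> s \<in> {0..t} \<Longrightarrow> \<bar>r - s\<bar> < \<delta> \<Longrightarrow> \<bar>V r - V s\<bar> < w"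
    using compact_uniformly_continuous[OF V compact_Icc] w(1)
    unfolding uniformly_continuous_on_def dist_real_def by metis
  have "\<forall>\<^sub>F n in sequentially. mesh (\<pi> n) < \<delta>"
    using order_tendstoD(2)[OF D(2) \<delta>(1)] .
  then show "\<forall>\<^sub>F n in sequentially. dist (weighted_sq_sum h V a b (\<pi> n) -
      (weighted_sq_sum h V a c (\<pi> n) + weighted_sq_sum h V c b (\<pi> n))) 0 < e"
  proof eventually_elim
    case (elim n)
    have "\<bar>V r - V s\<bar> \<le> w" if "r \<in> {0..t}" "s \<in> {0..t}" "\<bar>r - s\<bar> \<le> mesh (\<pi> n)" for r s
      using \<delta>(2)[OF that(1,2)] that(3) elim by simp
    then have "\<bar>weighted_sq_sum h V a b (\<pi> n) - (weighted_sq_sum h V a c (\<pi> n) +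
        weighted_sq_sum h V c b (\<pi> n))\<bar> \<le> 2 * H * w\<^sup>2"
      using w by (intro weighted_sq_sum_split_le[OF D(1) abc H(2)]) auto
    then show ?case using w by (simp add: dist_real_def)
  qed
qed

lemma quad_var_increment:
  assumes \<pi>: "partition_sequence t \<pi>" and V: "continuous_on {0..t} V"
    and qv: "has_cont_quad_var t \<pi> V" and ab: "0 \<le> a" "a \<le> b" "b \<le> t"
  shows "(\<lambda>n. weighted_sq_sum (\<lambda>_. 1) V a b (\<pi> n)) \<longlonglongrightarrow> quad_var \<pi> V b - quad_var \<pi> V a"
proof -
  have lim: "(\<lambda>n. weighted_sq_sum (\<lambda>_. 1) V 0 s (\<pi> n)) \<longlonglongrightarrow> quad_var \<pi> V s" if "s \<in> {0..t}" for s
  proof -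
    have "quad_var_sum \<pi> V s = (\<lambda>n. weighted_sq_sum (\<lambda>_. 1) V 0 s (\<pi> n))"
      using quad_var_sum_eq_weighted_sq_sum[OF partition_sequenceD(1)[OF \<pi>]] that by auto
    then show ?thesis
      using qv that unfolding has_cont_quad_var_def quad_var_def convergent_LIMSEQ_iff by metis
  qed
  have "(\<lambda>n. weighted_sq_sum (\<lambda>_. 1) V 0 b (\<pi> n) - weighted_sq_sum (\<lambda>_. 1) V 0 a (\<pi> n)
      - (weighted_sq_sum (\<lambda>_. 1) V 0 b (\<pi> n) -
      (weighted_sq_sum (\<lambda>_. 1) V 0 a (\<pi> n) + weighted_sq_sum (\<lambda>_. 1) V a b (\<pi> n))))
      \<longlonglongrightarrow> quad_var \<pi> V b - quad_var \<pi> V a - 0"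
    by (intro tendsto_diff lim weighted_sq_sum_split_tendsto[OF \<pi>] V) (use ab in auto)
  then show ?thesis by (simp add: algebra_simps)
qed

text \<open>For a fixed partition the sum of squares up to time \<open>s\<close> need not increase with \<open>s\<close>, because its last
  increment may shrink. Monotonicity appears only in the limit, where the increment of the quadratic
  variation is a limit of sums of squares.\<close>

lemma quad_var_mono:
  assumes "partition_sequence t \<pi>" "continuous_on {0..t} V"
    and "has_cont_quad_var t \<pi> V" "0 \<le> a" "a \<le> b" "b \<le> t"
  shows "quad_var \<pi> V a \<le> quad_var \<pi> V b"
proof -
  have "0 \<le> quad_var \<pi> V b - quad_var \<pi> V a"
    by (rule LIMSEQ_le_const[OF quad_var_increment[OF assms]])
       (auto simp: weighted_sq_sum_def intro!: sum_nonneg)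
  then show ?thesis by simp
qed

text \<open>The measures with mass \<open>(V (Sup k) - V (Inf k))\<^sup>2\<close> at \<open>Inf k\<close> converge weakly to the measure with
  distribution function \<open>quad_var \<pi> V\<close>. Fix \<open>\<epsilon>\<close>. On an interval \<open>{a..b}\<close> on which \<open>h\<close> is constant up to
  \<open>\<epsilon> / 2\<close>, the sums and the integral differ asymptotically by at most \<open>\<epsilon>\<close> times the increment of the
  quadratic variation. This error bound adds up when intervals are joined, so by bisection it holds
  on \<open>{0..t}\<close>.\<close>

lemma weighted_sq_sum_tendsto_integral:
  assumes \<pi>: "partition_sequence t \<pi>" and "0 \<le> t" and V: "continuous_on {0..t} V"
    and h: "continuous_on {0..t} h" and qv: "has_cont_quad_var t \<pi> V"
  shows "(\<lambda>n. weighted_sq_sum h V 0 t (\<pi> n)) \<longlonglongrightarrow> stieltjes_integral t h (quad_var \<pi> V)"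
proof -
  note D = partition_sequenceD[OF \<pi>]
  define F where "F s = quad_var \<pi> V (max 0 (min t s))" for s
  define \<mu> where "\<mu> = interval_measure F"
  define J where "J a b = (LINT r:{a..b}|\<mu>. h r)" for a b
  have F_mono: "F r \<le> F s" if "r \<le> s" for r s
    unfolding F_def using that \<open>0 \<le> t\<close> by (intro quad_var_mono[OF \<pi> V qv]) auto
  have F_cont: "continuous_on UNIV F"
    unfolding F_def
    by (rule continuous_on_compose2[where t = "{0..t}" and g = "quad_var \<pi> V"])
       (use qv \<open>0 \<le> t\<close> in \<open>auto simp: has_cont_quad_var_def intro!: continuous_intros\<close>)
  have em: "emeasure \<mu> {a..b} = F b - F a" if "a \<le> b" for a b
    unfolding \<mu>_def by (rule emeasure_interval_measure_Icc[OF that F_mono F_cont])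
  have [measurable_cong, simp]: "sets \<mu> = sets borel" by (simp add: \<mu>_def)
  have [simp]: "space \<mu> = UNIV" by (simp add: \<mu>_def)
  have ms: "measure \<mu> {a..b} = F b - F a" if "a \<le> b" for a b
    using em[OF that] F_mono[OF that] by (simp add: measure_def)
  have int: "set_integrable \<mu> {a..b} g"
    if "0 \<le> a" "a \<le> b" "b \<le> t" "continuous_on {0..t} g" for a b and g :: "real \<Rightarrow> real"
  proof -
    have c: "continuous_on {a..b} g" using continuous_on_subset[OF that(4)] that by auto
    obtain H where H: "\<And>r. r \<in> {a..b} \<Longrightarrow> norm (g r) \<le> H"
      using compact_imp_bounded[OF compact_continuous_image[OF c compact_Icc]]
      unfolding bounded_iff by blast
    have "(\<lambda>r. indicator {a..b} r *\<^sub>R g r) \<in> borel_measurable \<mu>"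
      using borel_measurable_continuous_on_indicator[OF _ c] by (simp cong: measurable_cong_sets)
    then show ?thesis
      unfolding set_integrable_def
      by (intro integrableI_bounded_set[where A = "{a..b}" and B = H])
         (use H em[OF \<open>a \<le> b\<close>] in \<open>auto split: split_indicator\<close>)
  qed
  have int_const: "(LINT r:{a..b}|\<mu>. c) = c * (F b - F a)" if "a \<le> b" for a b c :: real
    using em[OF that] ms[OF that] by (simp add: set_lebesgue_integral_def)
  have J_add: "J a b = J a c + J c b" if "0 \<le> a" "a \<le> c" "c \<le> b" "b \<le> t" for a b c
  proof -
    have "{c} \<in> null_sets \<mu>" using em[of c c] by (auto simp: null_sets_def)
    \<comment> \<open>The integrator is continuous, so the common end point carries no mass.\<close>
    then have "AE r in \<mu>. r \<noteq> c" using AE_not_in by fastforce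
    then have "AE r in \<mu>. \<not> (r \<in> {a..c} \<and> r \<in> {c..b})" by eventually_elim auto
    then have "(LINT r:{a..c} \<union> {c..b}|\<mu>. h r) = J a c + J c b"
      unfolding J_def using that by (intro set_integral_Un_AE int h) auto
    moreover have "{a..c} \<union> {c..b} = {a..b}" using that by auto
    ultimately show ?thesis by (simp add: J_def)
  qed
  have J_local: "\<bar>J a b - h x * (F b - F a)\<bar> \<le> \<epsilon> * (F b - F a)"
    if "0 \<le> a" "a \<le> b" "b \<le> t" "\<And>r. r \<in> {a..b} \<Longrightarrow> \<bar>h r - h x\<bar> \<le> \<epsilon>" for a b x \<epsilon>
  proof -
    have "J a b - h x * (F b - F a) = (LINT r:{a..b}|\<mu>. h r - h x)"
      unfolding J_def int_const[OF \<open>a \<le> b\<close>, symmetric] using that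
      by (intro set_integral_diff(2)[symmetric] int h continuous_intros) auto
    moreover have "norm (LINT r:{a..b}|\<mu>. h r - h x) \<le> (LINT r:{a..b}|\<mu>. norm (h r - h x))"
      using that by (intro set_integral_norm_bound int h continuous_intros) auto
    moreover have "(LINT r:{a..b}|\<mu>. norm (h r - h x)) \<le> (LINT r:{a..b}|\<mu>. \<epsilon>)"
      using that by (intro set_integral_mono int h continuous_intros) auto
    ultimately show ?thesis using int_const[OF \<open>a \<le> b\<close>] by simp
  qed
  have Q: "(\<lambda>n. weighted_sq_sum (\<lambda>_. 1) V a b (\<pi> n)) \<longlonglongrightarrow> F b - F a"
    if "0 \<le> a" "a \<le> b" "b \<le> t" for a b
    using quad_var_increment[OF \<pi> V qv that] that by (simp add: F_def)
  \<comment> \<open>The slack \<open>e\<close> absorbs all errors that vanish as \<open>n\<close> grows.\<close>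
  define good where "good \<epsilon> a b \<longleftrightarrow> (0 \<le> a \<and> b \<le> t \<longrightarrow> (\<forall>e>0. \<forall>\<^sub>F n in sequentially.
      \<bar>weighted_sq_sum h V a b (\<pi> n) - J a b\<bar> < \<epsilon> * (F b - F a) + e))" for \<epsilon> a b
  have good: "good \<epsilon> 0 t" if "0 < \<epsilon>" for \<epsilon>
    using \<open>0 \<le> t\<close>
  \<comment> \<open>Bisection: the bound passes to unions of adjacent intervals and holds near every point.\<close>
  proof (induction rule: Bolzano)
    case (trans a c b)
    show ?case
      unfolding good_def
    proof (intro impI allI, elim conjE)
      fix e :: real assume e: "0 < e" and ab: "0 \<le> a" "b \<le> t"
      have 1: "\<forall>\<^sub>F n in sequentially. \<bar>weighted_sq_sum h V a c (\<pi> n) - J a c\<bar> < \<epsilon> * (F c - F a) + e / 3"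
        using trans(1)[unfolded good_def, rule_format, of "e / 3"] trans(3,4) ab e by simp
      have 2: "\<forall>\<^sub>F n in sequentially. \<bar>weighted_sq_sum h V c b (\<pi> n) - J c b\<bar> < \<epsilon> * (F b - F c) + e / 3"
        using trans(2)[unfolded good_def, rule_format, of "e / 3"] trans(3,4) ab e by simp
      have "\<forall>\<^sub>F n in sequentially. dist (weighted_sq_sum h V a b (\<pi> n) -
          (weighted_sq_sum h V a c (\<pi> n) + weighted_sq_sum h V c b (\<pi> n))) 0 < e / 3"
        using e ab trans(3,4)
        by (intro tendstoD[OF weighted_sq_sum_split_tendsto[OF \<pi>]] V h) auto
      with 1 2 show "\<forall>\<^sub>F n in sequentially.
          \<bar>weighted_sq_sum h V a b (\<pi> n) - J a b\<bar> < \<epsilon> * (F b - F a) + e"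
      proof eventually_elim
        case (elim n)
        have "J a b = J a c + J c b" using J_add[OF ab(1) trans(3,4) ab(2)] .
        moreover have "\<epsilon> * (F b - F a) = \<epsilon> * (F c - F a) + \<epsilon> * (F b - F c)"
          by (simp add: algebra_simps)
        ultimately show ?case using elim unfolding dist_real_def by linarith
      qed
    qed
  next
    case (local x)
    then have "x \<in> {0..t}" by auto
    then obtain \<delta> where \<delta>: "0 < \<delta>" "\<And>r. r \<in> {0..t} \<Longrightarrow> \<bar>r - x\<bar> < \<delta> \<Longrightarrow> \<bar>h r - h x\<bar> < \<epsilon> / 2"
      using h[unfolded continuous_on_iff dist_real_def, rule_format, of x "\<epsilon> / 2"] \<open>0 < \<epsilon>\<close> by auto
    have "good \<epsilon> a b" if "a \<le> x" "x \<le> b" "b - a < \<delta> / 2" for a b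
      unfolding good_def
    proof (intro impI allI, elim conjE)
      fix e :: real assume e: "0 < e" and ab: "0 \<le> a" "b \<le> t"
      let ?q = "\<lambda>n. weighted_sq_sum (\<lambda>_. 1) V a b (\<pi> n)"
      have "a \<le> b" using that by simp
      have Jb: "\<bar>J a b - h x * (F b - F a)\<bar> \<le> \<epsilon> / 2 * (F b - F a)"
      proof (rule J_local[OF ab(1) \<open>a \<le> b\<close> ab(2)])
        fix r assume "r \<in> {a..b}"
        then have "r \<in> {0..t}" "\<bar>r - x\<bar> < \<delta>" using ab that \<delta>(1) by auto
        then show "\<bar>h r - h x\<bar> \<le> \<epsilon> / 2" using \<delta>(2)[of r] by simp
      qed
      have near: "\<bar>weighted_sq_sum h V a b (\<pi> n) - h x * ?q n\<bar> \<le> \<epsilon> / 2 * ?q n"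
        if m: "mesh (\<pi> n) < \<delta> / 2" for n
      proof -
        have *: "\<bar>h (Inf k) - h x\<bar> \<le> \<epsilon> / 2"
          if k: "k \<in> \<pi> n" and ne: "clamp_between a b (Sup k) \<noteq> clamp_between a b (Inf k)" for k
        proof -
          note K = division_of_interval_bounds[OF D(1) k] length_le_mesh[OF D(1) k]
          \<comment> \<open>Only intervals that meet the interior of \<open>{a..b}\<close> contribute, and their left end points are near \<open>x\<close>.\<close>
          have "a < Sup k" "Inf k < b"
            using ne K(1) \<open>a \<le> b\<close> unfolding clamp_between_def by linarith+
          then have "\<bar>Inf k - x\<bar> < \<delta>"
            using K m \<open>a \<le> x\<close> \<open>x \<le> b\<close> \<open>b - a < \<delta> / 2\<close> by linarith
          then show ?thesis using \<delta>(2)[of "Inf k"] K by force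
        qed
        have eq: "weighted_sq_sum h V a b (\<pi> n) - h x * ?q n = (\<Sum>k\<in>\<pi> n. (h (Inf k) - h x) *
            (V (clamp_between a b (Sup k)) - V (clamp_between a b (Inf k)))\<^sup>2)"
          unfolding weighted_sq_sum_def
          by (simp add: sum_distrib_left sum_subtractf[symmetric] algebra_simps)
        have "\<bar>weighted_sq_sum h V a b (\<pi> n) - h x * ?q n\<bar> \<le> (\<Sum>k\<in>\<pi> n. \<epsilon> / 2 *
            (V (clamp_between a b (Sup k)) - V (clamp_between a b (Inf k)))\<^sup>2)"
          unfolding eq
        proof (rule order_trans[OF sum_abs sum_mono])
          fix k assume k: "k \<in> \<pi> n"
          show "\<bar>(h (Inf k) - h x) * (V (clamp_between a b (Sup k)) - V (clamp_between a b (Inf k)))\<^sup>2\<bar>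
              \<le> \<epsilon> / 2 * (V (clamp_between a b (Sup k)) - V (clamp_between a b (Inf k)))\<^sup>2"
          proof (cases "clamp_between a b (Sup k) = clamp_between a b (Inf k)")
            case False
            from mult_right_mono[OF *[OF k False] zero_le_power2] show ?thesis
              by (simp only: abs_mult abs_power2)
          qed simp
        qed
        then show ?thesis by (simp only: weighted_sq_sum_def sum_distrib_left mult_1)
      qed
      have "(\<lambda>n. \<epsilon> / 2 * ?q n + \<bar>h x * ?q n - h x * (F b - F a)\<bar>) \<longlonglongrightarrow>
          \<epsilon> / 2 * (F b - F a) + \<bar>h x * (F b - F a) - h x * (F b - F a)\<bar>"
        using ab that by (intro tendsto_intros Q) auto
      then have "\<forall>\<^sub>F n in sequentially. \<epsilon> / 2 * ?q n + \<bar>h x * ?q n - h x * (F b - F a)\<bar>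
          < \<epsilon> / 2 * (F b - F a) + e"
        by (rule order_tendstoD) (use e in simp)
      moreover have "\<forall>\<^sub>F n in sequentially. mesh (\<pi> n) < \<delta> / 2"
        by (rule order_tendstoD(2)[OF D(2)]) (use \<delta>(1) in simp)
      ultimately show "\<forall>\<^sub>F n in sequentially.
          \<bar>weighted_sq_sum h V a b (\<pi> n) - J a b\<bar> < \<epsilon> * (F b - F a) + e"
      proof eventually_elim
        case (elim n)
        have "\<bar>S - j\<bar> < B + B + e"
          if "\<bar>S - p\<bar> \<le> A" "A + \<bar>p - r\<bar> < B + e" "\<bar>j - r\<bar> \<le> B" for S j p r A B :: real
          using that by linarith
        from this[OF near[OF elim(2)] elim(1) Jb] show ?case
          by (simp only: distrib_right[symmetric] field_sum_of_halves)
      qed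
    qed
    then show ?case using \<delta>(1) by (intro exI[of _ "\<delta> / 2"]) auto
  qed
  have "(\<lambda>n. weighted_sq_sum h V 0 t (\<pi> n)) \<longlonglongrightarrow> J 0 t"
  proof (rule tendstoI)
    fix e :: real assume "0 < e"
    define \<epsilon> where "\<epsilon> = e / (2 * (F t - F 0 + 1))"
    have "0 \<le> F t - F 0" using F_mono[of 0 t] \<open>0 \<le> t\<close> by simp
    then have "0 < \<epsilon>" "\<epsilon> * (F t - F 0) \<le> e / 2"
      using \<open>0 < e\<close> by (auto simp: \<epsilon>_def field_simps)
    with good[of \<epsilon>] \<open>0 < e\<close> have "\<forall>\<^sub>F n in sequentially.
        \<bar>weighted_sq_sum h V 0 t (\<pi> n) - J 0 t\<bar> < \<epsilon> * (F t - F 0) + e / 2"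
      unfolding good_def by auto
    then show "\<forall>\<^sub>F n in sequentially. dist (weighted_sq_sum h V 0 t (\<pi> n)) (J 0 t) < e"
      by eventually_elim (use \<open>\<epsilon> * (F t - F 0) \<le> e / 2\<close> in \<open>simp add: dist_real_def\<close>)
  qed
  then show ?thesis
    by (simp add: J_def \<mu>_def F_def[abs_def] stieltjes_integral_def)
qed

lemma reversed_partitions_sum:
  assumes d: "\<pi> n division_of {0..t}"
  shows "(\<Sum>k\<in>reversed_partitions t \<pi> n. f (Inf k) (Sup k)) = (\<Sum>k\<in>\<pi> n. f (t - Sup k) (t - Inf k))"
proof -
  have inj: "inj_on ((`) (\<lambda>r. t - r)) (\<pi> n)"
  proof (rule inj_onI)
    fix k l assume "(\<lambda>r. t - r) ` k = (\<lambda>r. t - r) ` l"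
    moreover have "inj (\<lambda>r. t - r)" by (simp add: inj_on_def)
    ultimately show "k = l" by (simp only: inj_image_eq_iff)
  qed
  have "Inf ((\<lambda>r. t - r) ` k) = t - Sup k \<and> Sup ((\<lambda>r. t - r) ` k) = t - Inf k" if k_in: "k \<in> \<pi> n" for k
  proof -
    obtain l u where k: "k = {l..u}" "l \<le> u" "0 \<le> l" "u \<le> t" using division_of_interval_eq[OF d k_in] .
    then have "(\<lambda>r. t - r) ` k = {t - u..t - l}" by simp
    then show ?thesis using k by simp
  qed
  then show ?thesis
    unfolding reversed_partitions_def sum.reindex[OF inj] by (intro sum.cong) auto
qed

text \<open>Under reversal the sum for \<open>U\<close> up to time \<open>s\<close> becomes the sum for \<open>\<beta>\<close> over \<open>{t - s..t}\<close>. By asymptotic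
  additivity the latter is the sum for \<open>\<beta>\<close> over \<open>{0..t}\<close> minus the one over \<open>{0..t - s}\<close>, up to an
  error that tends to 0. The relation is symmetric in \<open>U\<close> and \<open>\<beta>\<close>, so one transfer argument gives both
  directions.\<close>

lemma has_cont_quad_var_reversal:
  assumes \<pi>: "partition_sequence t \<pi>" and "0 \<le> t" and U: "continuous_on {0..t} U"
    and \<beta>: "\<And>s. s \<in> {0..t} \<Longrightarrow> \<beta> s = U t - U (t - s)"
  shows "has_cont_quad_var t (reversed_partitions t \<pi>) U \<longleftrightarrow> has_cont_quad_var t \<pi> \<beta>"
proof -
  note D = partition_sequenceD[OF \<pi>]
  let ?p = "quad_var_sum (reversed_partitions t \<pi>) U" and ?q = "quad_var_sum \<pi> \<beta>"
  have \<beta>_cont: "continuous_on {0..t} \<beta>"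
  proof -
    have "continuous_on {0..t} (\<lambda>s. U t - U (t - s))"
      by (intro continuous_intros continuous_on_compose2[OF U]) auto
    then show ?thesis
      by (rule continuous_on_eq) (simp add: \<beta>)
  qed
  have p_eq: "?p s n = weighted_sq_sum (\<lambda>_. 1) \<beta> (t - s) t (\<pi> n)" if "s \<in> {0..t}" for s n
    unfolding quad_var_sum_def weighted_sq_sum_def
      reversed_partitions_sum[OF D(1), of "\<lambda>a b. (U (min b s) - U (min a s))\<^sup>2"]
  proof (rule sum.cong)
    fix k assume "k \<in> \<pi> n"
    note K = division_of_interval_bounds[OF D(1) this]
    have "clamp_between (t - s) t r = t - min (t - r) s" if "r \<le> t" for r
      using that \<open>s \<in> {0..t}\<close> by (auto simp: clamp_between_def)
    then show "(U (min (t - Inf k) s) - U (min (t - Sup k) s))\<^sup>2 =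
        1 * (\<beta> (clamp_between (t - s) t (Sup k)) - \<beta> (clamp_between (t - s) t (Inf k)))\<^sup>2"
      using K that \<beta>[of "t - min (t - Inf k) s"] \<beta>[of "t - min (t - Sup k) s"] by auto
  qed simp
  have q_eq: "?q s n = weighted_sq_sum (\<lambda>_. 1) \<beta> 0 s (\<pi> n)" if "s \<in> {0..t}" for s n
    using quad_var_sum_eq_weighted_sq_sum[OF D(1)] that by auto
  have total: "?p t n = ?q t n" for n
    using p_eq[of t n] q_eq[of t n] \<open>0 \<le> t\<close> by simp
  have split: "(\<lambda>n. ?q t n - (?q (t - s) n + ?p s n)) \<longlonglongrightarrow> 0" if s: "s \<in> {0..t}" for s
  proof -
    have "(\<lambda>n. weighted_sq_sum (\<lambda>_. 1) \<beta> 0 t (\<pi> n) - (weighted_sq_sum (\<lambda>_. 1) \<beta> 0 (t - s) (\<pi> n) +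
        weighted_sq_sum (\<lambda>_. 1) \<beta> (t - s) t (\<pi> n))) \<longlonglongrightarrow> 0"
      using s by (intro weighted_sq_sum_split_tendsto[OF \<pi>] \<beta>_cont) auto
    then show ?thesis using s \<open>0 \<le> t\<close> by (simp add: p_eq q_eq)
  qed
  have transfer: "has_cont_quad_var t \<rho> V"
    if tr: "has_cont_quad_var t \<sigma> W" "\<And>n. quad_var_sum \<rho> V t n = quad_var_sum \<sigma> W t n"
      "\<And>s. s \<in> {0..t} \<Longrightarrow> (\<lambda>n. quad_var_sum \<sigma> W t n - (quad_var_sum \<sigma> W (t - s) n + quad_var_sum \<rho> V s n)) \<longlonglongrightarrow> 0"
    for \<rho> \<sigma> and V W :: "real \<Rightarrow> real"
  proof -
    have lim: "quad_var_sum \<sigma> W s \<longlonglongrightarrow> quad_var \<sigma> W s" if "s \<in> {0..t}" for s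
      using tr(1) that
      unfolding has_cont_quad_var_def quad_var_def convergent_LIMSEQ_iff by blast
    have lim': "quad_var_sum \<rho> V s \<longlonglongrightarrow> quad_var \<sigma> W t - quad_var \<sigma> W (t - s)" if s: "s \<in> {0..t}" for s
    proof -
      have "(\<lambda>n. quad_var_sum \<sigma> W t n - quad_var_sum \<sigma> W (t - s) n -
          (quad_var_sum \<sigma> W t n - (quad_var_sum \<sigma> W (t - s) n + quad_var_sum \<rho> V s n)))
          \<longlonglongrightarrow> quad_var \<sigma> W t - quad_var \<sigma> W (t - s) - 0"
        using s \<open>0 \<le> t\<close> by (intro tendsto_diff lim tr(3)) auto
      then show ?thesis by simp
    qed
    have "quad_var \<rho> V s = quad_var \<sigma> W t - quad_var \<sigma> W (t - s)" if "s \<in> {0..t}" for s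
      unfolding quad_var_def[of \<rho>] using limI[OF lim'[OF that]] .
    moreover have "continuous_on {0..t} (\<lambda>s. quad_var \<sigma> W t - quad_var \<sigma> W (t - s))"
    proof -
      have "continuous_on {0..t} (quad_var \<sigma> W)" using tr(1) by (simp add: has_cont_quad_var_def)
      then have "continuous_on {0..t} (\<lambda>s. quad_var \<sigma> W (t - s))"
        by (rule continuous_on_compose2) (auto intro: continuous_intros)
      then show ?thesis by (intro continuous_on_diff continuous_on_const)
    qed
    ultimately have "continuous_on {0..t} (quad_var \<rho> V)"
      by (metis (no_types, lifting) continuous_on_cong)
    with lim' show ?thesis
      unfolding has_cont_quad_var_def by (blast intro: convergentI)
  qed
  show ?thesis
  proof
    assume "has_cont_quad_var t \<pi> \<beta>"
    then show "has_cont_quad_var t (reversed_partitions t \<pi>) U"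
      by (rule transfer[OF _ total split])
  next
    assume "has_cont_quad_var t (reversed_partitions t \<pi>) U"
    then show "has_cont_quad_var t \<pi> \<beta>"
    proof (rule transfer[OF _ total[symmetric]])
      fix s assume "s \<in> {0..t}"
      then show "(\<lambda>n. ?p t n - (?p (t - s) n + ?q s n)) \<longlonglongrightarrow> 0"
        using split[of "t - s"] by (simp add: total add.commute)
    qed
  qed
qed

section \<open>The inverse Loewner flow\<close>

text \<open>The integral operator is conjugated by the weight \<open>exp (\<kappa> * s)\<close>. In the supremum norm the conjugated
  operator has Lipschitz constant at most \<open>L / \<kappa>\<close>, so for \<open>\<kappa> = 2 * L + 1\<close> it is a contraction on an
  interval of any length.\<close>

lemma picard_lindeloef_global:
  fixes F :: "real \<Rightarrow> 'a::banach \<Rightarrow> 'a"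
  assumes "0 \<le> t" and "0 \<le> L"
    and cont: "\<And>\<phi>. continuous_on {0..t} \<phi> \<Longrightarrow> continuous_on {0..t} (\<lambda>s. F s (\<phi> s))"
    and lip: "\<And>s p q. s \<in> {0..t} \<Longrightarrow> norm (F s p - F s q) \<le> L * norm (p - q)"
  shows "\<exists>\<phi>. continuous_on {0..t} \<phi> \<and> (\<forall>s\<in>{0..t}. \<phi> s = w + integral {0..s} (\<lambda>r. F r (\<phi> r)))"
proof -
  define c where "c s = max 0 (min t s)" for s
  have c: "c s \<in> {0..t}" "s \<in> {0..t} \<Longrightarrow> c s = s" for s using \<open>0 \<le> t\<close> by (auto simp: c_def)
  have c_cont: "continuous_on A c" for A unfolding c_def by (intro continuous_intros)
  define \<kappa> where "\<kappa> = 2 * L + 1"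
  have \<kappa>: "0 < \<kappa>" using \<open>0 \<le> L\<close> by (simp add: \<kappa>_def)
  define I where "I \<psi> s = w + integral {0..s} (\<lambda>r. F r (exp (\<kappa> * r) *\<^sub>R \<psi> r))" for \<psi> s
  define T where "T \<psi> = Bcontfun (\<lambda>s. exp (- \<kappa> * c s) *\<^sub>R I (apply_bcontfun \<psi>) (c s))" for \<psi> :: "real \<Rightarrow>\<^sub>C 'a"
  have F_cont: "continuous_on {0..t} (\<lambda>r. F r (exp (\<kappa> * r) *\<^sub>R apply_bcontfun \<psi> r))" for \<psi>
    by (intro cont continuous_intros continuous_on_apply_bcontfun)
  have F_int: "(\<lambda>r. F r (exp (\<kappa> * r) *\<^sub>R apply_bcontfun \<psi> r)) integrable_on {0..s}" if "s \<in> {0..t}" for \<psi> s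
    by (rule integrable_continuous_real[OF continuous_on_subset[OF F_cont]]) (use that in auto)
  have T: "apply_bcontfun (T \<psi>) s = exp (- \<kappa> * c s) *\<^sub>R I (apply_bcontfun \<psi>) (c s)" for \<psi> s
  proof -
    let ?g = "\<lambda>s. exp (- \<kappa> * s) *\<^sub>R I (apply_bcontfun \<psi>) s"
    have g: "continuous_on {0..t} ?g"
      unfolding I_def by (intro continuous_intros indefinite_integral_continuous_1 F_int) (use \<open>0 \<le> t\<close> in auto)
    have "continuous_on UNIV (\<lambda>s. ?g (c s))"
      by (rule continuous_on_compose2[OF g c_cont]) (use c in auto)
    moreover have "bounded (range (\<lambda>s. ?g (c s)))"
      by (rule bounded_subset[OF compact_imp_bounded[OF compact_continuous_image[OF g compact_Icc]]])
         (use c in blast)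
    ultimately show ?thesis unfolding T_def by (subst Bcontfun_inverse) (auto simp: bcontfun_def)
  qed
  have "\<exists>!\<psi>. T \<psi> = \<psi>"
  proof (rule banach_fix_type[where c = "1/2"]; (intro allI dist_bound)?)
    fix \<psi>1 \<psi>2 :: "real \<Rightarrow>\<^sub>C 'a" and s
    let ?D = "dist \<psi>1 \<psi>2"
    define r where "r = c s"
    have r: "r \<in> {0..t}" using c by (simp add: r_def)
    have exp_int: "((\<lambda>q. L * (exp (\<kappa> * q) * ?D)) has_integral
        (L * (exp (\<kappa> * r) * ?D) / \<kappa> - L * (exp (\<kappa> * 0) * ?D) / \<kappa>)) {0..r}"
      using r \<kappa>
      by (intro fundamental_theorem_of_calculus)
         (auto intro!: derivative_eq_intros simp: has_real_derivative_iff_has_vector_derivative[symmetric])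
    have "dist (apply_bcontfun (T \<psi>1) s) (apply_bcontfun (T \<psi>2) s) =
        exp (- \<kappa> * r) * norm (integral {0..r} (\<lambda>q. F q (exp (\<kappa> * q) *\<^sub>R \<psi>1 q) - F q (exp (\<kappa> * q) *\<^sub>R \<psi>2 q)))"
      unfolding T r_def[symmetric] dist_norm scaleR_diff_right[symmetric] I_def
      using F_int[OF r] by (simp add: integral_diff)
    also have "\<dots> \<le> exp (- \<kappa> * r) * integral {0..r} (\<lambda>q. L * (exp (\<kappa> * q) * ?D))"
    proof (intro mult_left_mono integral_norm_bound_integral)
      fix q assume q: "q \<in> {0..r}"
      have "norm (F q (exp (\<kappa> * q) *\<^sub>R \<psi>1 q) - F q (exp (\<kappa> * q) *\<^sub>R \<psi>2 q))
          \<le> L * norm (exp (\<kappa> * q) *\<^sub>R \<psi>1 q - exp (\<kappa> * q) *\<^sub>R \<psi>2 q)"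
        using q r by (intro lip) auto
      also have "\<dots> = L * (exp (\<kappa> * q) * dist (\<psi>1 q) (\<psi>2 q))"
        by (simp add: scaleR_diff_right[symmetric] dist_norm)
      also have "\<dots> \<le> L * (exp (\<kappa> * q) * ?D)"
        using \<open>0 \<le> L\<close> by (intro mult_left_mono dist_bounded) auto
      finally show "norm (F q (exp (\<kappa> * q) *\<^sub>R \<psi>1 q) - F q (exp (\<kappa> * q) *\<^sub>R \<psi>2 q))
          \<le> L * (exp (\<kappa> * q) * ?D)" .
    qed (use F_int[OF r] exp_int in \<open>auto intro: integrable_diff\<close>)
    also have "\<dots> = L / \<kappa> * (1 - exp (- \<kappa> * r)) * ?D"
      unfolding integral_unique[OF exp_int] using \<kappa> by (simp add: exp_minus divide_simps) (simp add: algebra_simps)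
    also have "\<dots> \<le> 1 / 2 * 1 * ?D"
      using \<open>0 \<le> L\<close> r \<kappa> by (intro mult_right_mono mult_mono) (auto simp: \<kappa>_def divide_simps mult_nonpos_nonneg)
    finally show "dist (apply_bcontfun (T \<psi>1) s) (apply_bcontfun (T \<psi>2) s) \<le> 1 / 2 * ?D" by simp
  qed auto
  then obtain \<psi> where \<psi>: "T \<psi> = \<psi>" by auto
  define \<phi> where "\<phi> s = exp (\<kappa> * s) *\<^sub>R \<psi> s" for s
  have "\<phi> s = w + integral {0..s} (\<lambda>r. F r (\<phi> r))" if "s \<in> {0..t}" for s
    using T[of \<psi> s] c(2)[OF that] unfolding \<psi> \<phi>_def I_def by (simp add: exp_minus)
  moreover have "continuous_on {0..t} \<phi>"
    unfolding \<phi>_def by (intro continuous_intros continuous_on_apply_bcontfun)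
  ultimately show ?thesis by auto
qed

text \<open>The difference of two solutions solves the linear equation with coefficient
  \<open>- 2 / ((\<gamma> - U) * (\<eta> - U))\<close>. The resulting formula gives uniqueness forwards (the flow is well
  defined), uniqueness backwards (the flow is injective), and the difference quotients of the inverse
  flow.\<close>

lemma loewner_difference:
  fixes \<gamma> \<eta> :: "real \<Rightarrow> complex"
  assumes "a \<le> b" and U: "continuous_on {a..b} U"
    and \<gamma>: "\<And>r. r \<in> {a..b} \<Longrightarrow> \<gamma> r \<noteq> of_real (U r)"
      "\<And>r. r \<in> {a..b} \<Longrightarrow> (\<gamma> has_vector_derivative 2 / (\<gamma> r - of_real (U r))) (at r within {a..b})"
    and \<eta>: "\<And>r. r \<in> {a..b} \<Longrightarrow> \<eta> r \<noteq> of_real (U r)"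
      "\<And>r. r \<in> {a..b} \<Longrightarrow> (\<eta> has_vector_derivative 2 / (\<eta> r - of_real (U r))) (at r within {a..b})"
  shows "\<gamma> a - \<eta> a = (\<gamma> b - \<eta> b) *
    exp (integral {a..b} (\<lambda>r. 2 / ((\<gamma> r - of_real (U r)) * (\<eta> r - of_real (U r)))))"
proof -
  define k where "k r = 2 / ((\<gamma> r - of_real (U r)) * (\<eta> r - of_real (U r)))" for r
  have "continuous_on {a..b} \<gamma>" "continuous_on {a..b} \<eta>"
    unfolding continuous_on_eq_continuous_within
    using has_vector_derivative_continuous[OF \<gamma>(2)] has_vector_derivative_continuous[OF \<eta>(2)] by blast+
  then have k: "continuous_on {a..b} k"
    unfolding k_def using \<gamma>(1) \<eta>(1) U by (intro continuous_intros) auto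
  define E where "E r = (\<gamma> r - \<eta> r) * exp (integral {a..r} k)" for r
  have "(E has_vector_derivative 0) (at r within {a..b})" if r: "r \<in> {a..b}" for r
  proof -
    have 1: "((\<lambda>r. exp (integral {a..r} k)) has_vector_derivative k r * exp (integral {a..r} k)) (at r within {a..b})"
      using field_vector_diff_chain_within[OF integral_has_vector_derivative[OF k r]
          DERIV_subset[OF DERIV_exp subset_UNIV]]
      by (simp add: o_def)
    have 2: "((\<lambda>r. \<gamma> r - \<eta> r) has_vector_derivative - (k r * (\<gamma> r - \<eta> r))) (at r within {a..b})"
    proof -
      have "2 / p - 2 / q = - (2 / (p * q) * (p - q))" if "p \<noteq> 0" "q \<noteq> 0" for p q :: complex
        using that by (simp add: divide_simps)
      from this[of "\<gamma> r - of_real (U r)" "\<eta> r - of_real (U r)"]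
      have "2 / (\<gamma> r - of_real (U r)) - 2 / (\<eta> r - of_real (U r)) = - (k r * (\<gamma> r - \<eta> r))"
        using \<gamma>(1)[OF r] \<eta>(1)[OF r] by (simp add: k_def)
      then show ?thesis using has_vector_derivative_diff[OF \<gamma>(2)[OF r] \<eta>(2)[OF r]] by simp
    qed
    from has_vector_derivative_mult[OF 2 1] show ?thesis
      unfolding E_def by (simp add: algebra_simps)
  qed
  then have "\<exists>p. \<forall>r\<in>{a..b}. E r = p"
    by (intro has_derivative_zero_constant) (auto simp: has_vector_derivative_def)
  then have "E a = E b" using \<open>a \<le> b\<close> by fastforce
  then show ?thesis by (simp add: E_def k_def[abs_def])
qed


text \<open>Read backwards in time, the imaginary part of a solution increases, so a solution ending at \<open>w\<close> is
  expected to stay above the height \<open>c = Im w\<close> of its end point. Replacing \<open>p\<close> by its projection \<open>P p\<close>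
  to the half-plane above that height makes the vector field globally Lipschitz. The solution of the
  projected equation does stay above height \<open>c\<close>, hence solves the original one.\<close>

lemma loewner_backward_exists:
  assumes "0 \<le> t" and U: "continuous_on {0..t} U" and w: "0 < Im w"
  obtains \<gamma> where "\<gamma> t = w" "\<And>r. r \<in> {0..t} \<Longrightarrow> Im w \<le> Im (\<gamma> r)"
    "\<And>r. r \<in> {0..t} \<Longrightarrow> (\<gamma> has_vector_derivative 2 / (\<gamma> r - of_real (U r))) (at r within {0..t})"
proof -
  define c where "c = Im w"
  have c: "0 < c" using w by (simp add: c_def)
  define P where "P p = Complex (Re p) (max c (Im p))" for p
  define F where "F s p = - 2 / (P p - of_real (U (t - s)))" for s p
  have P_lower: "c \<le> norm (P p - of_real u)" for p u
    using abs_Im_le_cmod[of "P p - of_real u"] by (simp add: P_def)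
  have P_ne: "P p - of_real u \<noteq> 0" for p u
    using P_lower[of p u] c by auto
  have P_lip: "norm (P p - P q) \<le> 2 * norm (p - q)" for p q
  proof -
    have "norm (P p - P q) \<le> \<bar>Re (p - q)\<bar> + \<bar>max c (Im p) - max c (Im q)\<bar>"
      using cmod_le[of "P p - P q"] by (simp add: P_def)
    moreover have "\<bar>max c (Im p) - max c (Im q)\<bar> \<le> \<bar>Im (p - q)\<bar>" by auto
    ultimately show ?thesis
      using abs_Re_le_cmod[of "p - q"] abs_Im_le_cmod[of "p - q"] by linarith
  qed
  have V_cont: "continuous_on {0..t} (\<lambda>s. U (t - s))"
    by (rule continuous_on_compose2[OF U]) (auto intro: continuous_intros)
  have F_cont: "continuous_on {0..t} (\<lambda>s. F s (\<phi> s))" if "continuous_on {0..t} \<phi>" for \<phi>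
    unfolding F_def
  proof (rule continuous_on_divide)
    have "continuous_on {0..t} (\<lambda>s. P (\<phi> s))"
      unfolding P_def Complex_eq by (intro continuous_intros that)
    then show "continuous_on {0..t} (\<lambda>s. P (\<phi> s) - of_real (U (t - s)))"
      by (intro continuous_intros V_cont)
  qed (use P_ne in \<open>auto intro: continuous_intros\<close>)
  have F_lip: "norm (F s p - F s q) \<le> 4 / c\<^sup>2 * norm (p - q)" for s p q
  proof -
    let ?u = "of_real (U (t - s)) :: complex"
    have "F s p - F s q = 2 * (P p - P q) / ((P p - ?u) * (P q - ?u))"
      using P_ne[of p "U (t - s)"] P_ne[of q "U (t - s)"] by (simp add: F_def divide_simps)
    then have "norm (F s p - F s q) = 2 * norm (P p - P q) / (norm (P p - ?u) * norm (P q - ?u))"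
      by (simp only: norm_mult norm_divide norm_numeral)
    also have "\<dots> \<le> 2 * (2 * norm (p - q)) / (c * c)"
      using c by (intro frac_le mult_mono P_lower P_lip mult_left_mono) auto
    finally show ?thesis by (simp add: power2_eq_square)
  qed
  have "\<exists>\<phi>. continuous_on {0..t} \<phi> \<and> (\<forall>s\<in>{0..t}. \<phi> s = w + integral {0..s} (\<lambda>r. F r (\<phi> r)))"
    by (rule picard_lindeloef_global[OF \<open>0 \<le> t\<close> _ F_cont F_lip]) simp_all
  then obtain \<phi> where \<phi>: "continuous_on {0..t} \<phi>"
    "\<And>s. s \<in> {0..t} \<Longrightarrow> \<phi> s = w + integral {0..s} (\<lambda>r. F r (\<phi> r))"
    by blast
  note F\<phi> = F_cont[OF \<phi>(1)]
  have Im_\<phi>: "c \<le> Im (\<phi> s)" if s: "s \<in> {0..t}" for s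
  proof -
    have "(\<lambda>r. F r (\<phi> r)) integrable_on {0..s}"
      by (rule integrable_continuous_real[OF continuous_on_subset[OF F\<phi>]]) (use s in auto)
    from has_integral_linear[OF integrable_integral[OF this] bounded_linear_Im]
    have "((\<lambda>r. Im (F r (\<phi> r))) has_integral Im (integral {0..s} (\<lambda>r. F r (\<phi> r)))) {0..s}"
      by (simp add: o_def)
    moreover have "0 \<le> Im (F r p)" for r p
      using c by (auto simp: F_def Im_divide P_def intro!: divide_nonneg_nonneg add_nonneg_nonneg)
    ultimately have "0 \<le> Im (integral {0..s} (\<lambda>r. F r (\<phi> r)))"
      by (rule has_integral_nonneg)
    then show ?thesis using \<phi>(2)[OF s] by (simp add: c_def)
  qed
  have \<phi>_deriv: "(\<phi> has_vector_derivative - 2 / (\<phi> s - of_real (U (t - s)))) (at s within {0..t})"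
    if s: "s \<in> {0..t}" for s
  proof -
    have "P (\<phi> s) = \<phi> s" using Im_\<phi>[OF s] by (simp add: P_def complex_eq_iff)
    moreover have "((\<lambda>s. w + integral {0..s} (\<lambda>r. F r (\<phi> r))) has_vector_derivative F s (\<phi> s)) (at s within {0..t})"
      using has_vector_derivative_add[OF has_vector_derivative_const integral_has_vector_derivative[OF F\<phi> s]] by simp
    ultimately show ?thesis
      using has_vector_derivative_transform[OF s, of \<phi>] \<phi>(2) by (simp add: F_def)
  qed
  show thesis
  proof (rule that[of "\<lambda>r. \<phi> (t - r)"])
    show "\<phi> (t - t) = w" using \<phi>(2)[of 0] \<open>0 \<le> t\<close> by simp
    fix r assume r: "r \<in> {0..t}"
    then show "Im w \<le> Im (\<phi> (t - r))" using Im_\<phi>[of "t - r"] by (simp add: c_def)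
    have "(-) t ` {0..t} = {0..t}" by simp
    then have "((\<phi> \<circ> (\<lambda>r. t - r)) has_vector_derivative (- 1) *\<^sub>R (- 2 / (\<phi> (t - r) - of_real (U (t - (t - r))))))
        (at r within {0..t})"
      using r \<phi>_deriv[of "t - r"]
      by (intro vector_diff_chain_within) (auto intro!: derivative_eq_intros)
    then show "((\<lambda>r. \<phi> (t - r)) has_vector_derivative 2 / (\<phi> (t - r) - of_real (U r))) (at r within {0..t})"
      by (simp add: o_def)
  qed
qed

text \<open>The domain of the flow contains real starting points as well; injectivity holds for them too, as
  the difference formula does not refer to the half-plane.\<close>

lemma loewner_inverse_endpoint:
  assumes "0 \<le> t" and U: "continuous_on {0..t} U" and "U 0 = 0"
    and \<gamma>: "loewner_solution U (\<gamma> 0) t \<gamma>" and "0 \<le> Im (\<gamma> 0)"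
  shows "loewner_inverse U t (\<gamma> t) = \<gamma> 0"
proof -
  have diff: "\<eta> 0 - \<xi> 0 = (\<eta> t - \<xi> t) * exp (integral {0..t} (\<lambda>r. 2 / ((\<eta> r - of_real (U r)) * (\<xi> r - of_real (U r)))))"
    if "loewner_solution U a t \<eta>" "loewner_solution U b t \<xi>" for a b \<eta> \<xi>
    using that unfolding loewner_solution_def by (intro loewner_difference[OF \<open>0 \<le> t\<close> U]) auto
  have flow: "loewner_flow U t a = \<eta> t" if \<eta>: "loewner_solution U a t \<eta>" for a \<eta>
    unfolding loewner_flow_def
  proof (rule the_equality)
    fix w assume "\<exists>\<xi>. loewner_solution U a t \<xi> \<and> w = \<xi> t"
    then obtain \<xi> where \<xi>: "loewner_solution U a t \<xi>" "w = \<xi> t" by blast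
    then have "\<eta> 0 = \<xi> 0" using \<eta> by (simp add: loewner_solution_def)
    with diff[OF \<eta> \<xi>(1)] \<xi>(2) show "w = \<eta> t" by simp
  qed (use \<eta> in blast)
  have "\<gamma> 0 \<noteq> 0" using \<gamma>[unfolded loewner_solution_def, THEN conjunct2, THEN bspec, of 0] \<open>U 0 = 0\<close> \<open>0 \<le> t\<close>
    by simp
  then have dom: "\<gamma> 0 \<in> loewner_domain U t"
    using \<gamma> \<open>0 \<le> Im (\<gamma> 0)\<close> by (auto simp: loewner_domain_def)
  show ?thesis
    unfolding loewner_inverse_def the_inv_into_def
  proof (rule the_equality)
    show "\<gamma> 0 \<in> loewner_domain U t \<and> loewner_flow U t (\<gamma> 0) = \<gamma> t"
      using dom flow[OF \<gamma>] by simp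
    fix a assume a: "a \<in> loewner_domain U t \<and> loewner_flow U t a = \<gamma> t"
    then obtain \<xi> where \<xi>: "loewner_solution U a t \<xi>" by (auto simp: loewner_domain_def)
    have "\<xi> t = \<gamma> t" using a flow[OF \<xi>] by simp
    with diff[OF \<xi> \<gamma>] \<xi> show "a = \<gamma> 0" by (simp add: loewner_solution_def)
  qed
qed

text \<open>By the difference formula, the difference quotient of the inverse flow between \<open>v\<close> and \<open>w\<close> is the
  exponential of the integral of \<open>\<kappa> v w\<close>. For \<open>v \<rightarrow> w\<close> the solutions ending at \<open>v\<close> and \<open>w\<close> approach each
  other uniformly, again by the difference formula, so that the quotient converges.\<close>

lemma loewner_inverse_has_field_derivative:
  assumes "0 \<le> t" and U: "continuous_on {0..t} U" and "U 0 = 0"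
    and \<gamma>: "loewner_solution U (\<gamma> 0) t \<gamma>" and Im_\<gamma>: "0 < Im (\<gamma> t)"
  shows "(loewner_inverse U t has_field_derivative
    exp (integral {0..t} (\<lambda>r. 2 / (\<gamma> r - of_real (U r))\<^sup>2))) (at (\<gamma> t))"
proof -
  \<comment> \<open>Half the height of the end point: all nearby end points lie above \<open>c\<close>, which gives uniform
    bounds for the solutions through them.\<close>
  define c where "c = Im (\<gamma> t) / 2"
  have c: "0 < c" using Im_\<gamma> by (simp add: c_def)
  define good where "good w \<eta> \<longleftrightarrow> \<eta> t = w \<and> (\<forall>r\<in>{0..t}. Im w \<le> Im (\<eta> r) \<and>
    (\<eta> has_vector_derivative 2 / (\<eta> r - of_real (U r))) (at r within {0..t}))" for w and \<eta> :: "real \<Rightarrow> complex"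
  define \<Gamma> where "\<Gamma> w = (SOME \<eta>. good w \<eta>)" for w
  have \<Gamma>: "good w (\<Gamma> w)" if "c < Im w" for w
  proof -
    have "0 < Im w" using that c by simp
    then have "\<exists>\<eta>. good w \<eta>"
      using loewner_backward_exists[OF \<open>0 \<le> t\<close> U, of w] unfolding good_def by metis
    then show ?thesis unfolding \<Gamma>_def by (rule someI_ex)
  qed
  have lower: "c \<le> norm (\<Gamma> w r - of_real (U r))" if "c < Im w" "r \<in> {0..t}" for w r
    using \<Gamma>[OF that(1)] that abs_Im_le_cmod[of "\<Gamma> w r - of_real (U r)"] unfolding good_def by force
  have ne: "\<Gamma> w r \<noteq> of_real (U r)" if "c < Im w" "r \<in> {0..t}" for w r
    using lower[OF that] c by auto
  have deriv: "(\<Gamma> w has_vector_derivative 2 / (\<Gamma> w r - of_real (U r))) (at r within S)"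
    if "c < Im w" "r \<in> {0..t}" "S \<subseteq> {0..t}" for w r S
    using \<Gamma>[OF that(1)] that has_vector_derivative_within_subset unfolding good_def by blast
  define \<kappa> where "\<kappa> w v r = 2 / ((\<Gamma> w r - of_real (U r)) * (\<Gamma> v r - of_real (U r)))" for w v r
  have diff: "\<Gamma> w a - \<Gamma> v a = (w - v) * exp (integral {a..t} (\<kappa> w v))"
    if "c < Im w" "c < Im v" "a \<in> {0..t}" for w v a
  proof -
    have "\<Gamma> w a - \<Gamma> v a = (\<Gamma> w t - \<Gamma> v t) * exp (integral {a..t} (\<kappa> w v))"
      unfolding \<kappa>_def
      by (rule loewner_difference[OF _ continuous_on_subset[OF U]])
         (use that ne[OF that(1)] ne[OF that(2)] in \<open>auto intro!: deriv\<close>)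
    then show ?thesis using \<Gamma> that(1,2) by (simp add: good_def)
  qed
  have inv: "loewner_inverse U t w = \<Gamma> w 0" if "c < Im w" for w
  proof -
    have "loewner_inverse U t (\<Gamma> w t) = \<Gamma> w 0"
    proof (rule loewner_inverse_endpoint[OF \<open>0 \<le> t\<close> U \<open>U 0 = 0\<close>])
      show "loewner_solution U (\<Gamma> w 0) t (\<Gamma> w)"
        unfolding loewner_solution_def using ne[OF that] deriv[OF that _ subset_refl] by auto
      have "Im w \<le> Im (\<Gamma> w 0)" using \<Gamma>[OF that] \<open>0 \<le> t\<close> unfolding good_def by simp
      then show "0 \<le> Im (\<Gamma> w 0)" using that c by simp
    qed
    then show ?thesis using \<Gamma>[OF that] by (simp add: good_def)
  qed
  define w where "w = \<gamma> t"
  have w: "c < Im w" using Im_\<gamma> by (simp add: w_def c_def)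
  have \<gamma>_eq: "\<gamma> a = \<Gamma> w a" if a: "a \<in> {0..t}" for a
  proof -
    have "\<gamma> a - \<Gamma> w a = (\<gamma> t - \<Gamma> w t) *
        exp (integral {a..t} (\<lambda>r. 2 / ((\<gamma> r - of_real (U r)) * (\<Gamma> w r - of_real (U r)))))"
    proof (rule loewner_difference[OF _ continuous_on_subset[OF U]])
      fix r assume r: "r \<in> {a..t}"
      then have "r \<in> {0..t}" using a by auto
      then show "\<gamma> r \<noteq> of_real (U r)" "\<Gamma> w r \<noteq> of_real (U r)"
        "(\<Gamma> w has_vector_derivative 2 / (\<Gamma> w r - of_real (U r))) (at r within {a..t})"
        using \<gamma> ne[OF w] deriv[OF w] a by (auto simp: loewner_solution_def)
      have "(\<gamma> has_vector_derivative 2 / (\<gamma> r - of_real (U r))) (at r within {0..t})"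
        using \<gamma> \<open>r \<in> {0..t}\<close> by (auto simp: loewner_solution_def)
      then show "(\<gamma> has_vector_derivative 2 / (\<gamma> r - of_real (U r))) (at r within {a..t})"
        by (rule has_vector_derivative_within_subset) (use a in auto)
    qed (use a in auto)
    then show ?thesis using \<Gamma>[OF w] by (simp add: good_def w_def)
  qed
  have \<kappa>_cont: "continuous_on {0..t} (\<kappa> v w)" if "c < Im v" for v
  proof -
    have "continuous_on {0..t} (\<Gamma> u)" if "c < Im u" for u
      using has_vector_derivative_continuous[OF deriv[OF that _ subset_refl]]
      unfolding continuous_on_eq_continuous_within by blast
    then show ?thesis
      unfolding \<kappa>_def using ne that w U by (intro continuous_intros) auto
  qed
  have \<kappa>_bound: "norm (\<kappa> v w r) \<le> 2 / c\<^sup>2" if "c < Im v" "r \<in> {0..t}" for v r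
    unfolding \<kappa>_def norm_divide norm_mult power2_eq_square using c
    by (auto intro!: frac_le mult_mono lower that w)
  have \<Gamma>_close: "norm (\<Gamma> v r - \<Gamma> w r) \<le> norm (v - w) * exp (2 / c\<^sup>2 * t)"
    if v: "c < Im v" and r: "r \<in> {0..t}" for v r
  proof -
    have "norm (integral {r..t} (\<kappa> v w)) \<le> 2 / c\<^sup>2 * (t - r)"
      using r by (intro integral_bound continuous_on_subset[OF \<kappa>_cont[OF v]] \<kappa>_bound[OF v]) auto
    also have "\<dots> \<le> 2 / c\<^sup>2 * t" using r by (intro mult_left_mono) auto
    finally have "norm (exp (integral {r..t} (\<kappa> v w))) \<le> exp (2 / c\<^sup>2 * t)"
      using norm_exp[of "integral {r..t} (\<kappa> v w)"] by (meson exp_le_cancel_iff order_trans)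
    then show ?thesis
      unfolding diff[OF v w r] norm_mult by (intro mult_left_mono) auto
  qed
  have int_close: "norm (integral {0..t} (\<kappa> v w) - integral {0..t} (\<kappa> w w)) \<le>
      2 / c ^ 3 * exp (2 / c\<^sup>2 * t) * t * norm (v - w)" if v: "c < Im v" for v
  proof -
    have "norm (\<kappa> v w r - \<kappa> w w r) \<le> 2 / c ^ 3 * (norm (v - w) * exp (2 / c\<^sup>2 * t))"
      if r: "r \<in> {0..t}" for r
    proof -
      let ?p = "\<Gamma> v r - of_real (U r)" and ?q = "\<Gamma> w r - of_real (U r)"
      have pq: "?p \<noteq> 0" "?q \<noteq> 0" using ne[OF v r] ne[OF w r] by auto
      have "2 / (p * q) - 2 / (q * q) = 2 * (q - p) / (p * q * q)" if "p \<noteq> 0" "q \<noteq> 0" for p q :: complex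
        using that by (simp add: divide_simps)
      from this[OF pq] have "\<kappa> v w r - \<kappa> w w r = 2 * (\<Gamma> w r - \<Gamma> v r) / (?p * ?q * ?q)"
        by (simp add: \<kappa>_def)
      then have "norm (\<kappa> v w r - \<kappa> w w r) = 2 * norm (\<Gamma> v r - \<Gamma> w r) / (norm ?p * norm ?q * norm ?q)"
        by (simp only: norm_mult norm_divide norm_numeral norm_minus_commute[of "\<Gamma> w r"])
      also have "\<dots> \<le> 2 * (norm (v - w) * exp (2 / c\<^sup>2 * t)) / (c * c * c)"
        using c by (intro frac_le mult_mono mult_left_mono \<Gamma>_close lower v w r) auto
      finally show ?thesis by (simp add: power3_eq_cube)
    qed
    then have "norm (integral {0..t} (\<lambda>r. \<kappa> v w r - \<kappa> w w r)) \<le>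
        2 / c ^ 3 * (norm (v - w) * exp (2 / c\<^sup>2 * t)) * (t - 0)"
      using \<open>0 \<le> t\<close> by (intro integral_bound continuous_on_diff \<kappa>_cont v w) auto
    moreover have "integral {0..t} (\<lambda>r. \<kappa> v w r - \<kappa> w w r) = integral {0..t} (\<kappa> v w) - integral {0..t} (\<kappa> w w)"
      by (intro integral_diff integrable_continuous_real \<kappa>_cont v w)
    ultimately show ?thesis by (simp add: algebra_simps)
  qed
  have ev: "\<forall>\<^sub>F v in at w. c < Im v"
  proof (rule eventually_at_in_open'[THEN eventually_mono])
    show "open {v. c < Im v}" by (rule open_halfspace_Im_gt)
  qed (use w in auto)
  have "((\<lambda>v. integral {0..t} (\<kappa> v w)) \<longlongrightarrow> integral {0..t} (\<kappa> w w)) (at w)"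
    unfolding Lim_null[of _ "integral {0..t} (\<kappa> w w)"]
  proof (rule Lim_null_comparison)
    have "((\<lambda>v. 2 / c ^ 3 * exp (2 / c\<^sup>2 * t) * t * norm (v - w)) \<longlongrightarrow>
        2 / c ^ 3 * exp (2 / c\<^sup>2 * t) * t * norm (w - w)) (at w)"
      by (intro tendsto_intros)
    then show "((\<lambda>v. 2 / c ^ 3 * exp (2 / c\<^sup>2 * t) * t * norm (v - w)) \<longlongrightarrow> 0) (at w)"
      by simp
    show "\<forall>\<^sub>F v in at w. norm (integral {0..t} (\<kappa> v w) - integral {0..t} (\<kappa> w w)) \<le>
        2 / c ^ 3 * exp (2 / c\<^sup>2 * t) * t * norm (v - w)"
      using ev by eventually_elim (rule int_close)
  qed
  then have "((\<lambda>v. exp (integral {0..t} (\<kappa> v w))) \<longlongrightarrow> exp (integral {0..t} (\<kappa> w w))) (at w)"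
    by (rule tendsto_exp)
  moreover have "\<forall>\<^sub>F v in at w. exp (integral {0..t} (\<kappa> v w)) =
      (loewner_inverse U t v - loewner_inverse U t w) / (v - w)"
    using ev eventually_neq_at_within[of w w UNIV]
  proof eventually_elim
    case (elim v)
    then show ?case using diff[OF elim(1) w, of 0] \<open>0 \<le> t\<close> by (simp add: inv w)
  qed
  ultimately have "((\<lambda>v. (loewner_inverse U t v - loewner_inverse U t w) / (v - w))
      \<longlongrightarrow> exp (integral {0..t} (\<kappa> w w))) (at w)"
    by (rule Lim_transform_eventually)
  then have "(loewner_inverse U t has_field_derivative exp (integral {0..t} (\<kappa> w w))) (at w)"
    by (simp add: has_field_derivative_iff)
  moreover have "integral {0..t} (\<kappa> w w) = integral {0..t} (\<lambda>r. 2 / (\<gamma> r - of_real (U r))\<^sup>2)"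
    by (rule integral_cong) (simp add: \<kappa>_def \<gamma>_eq power2_eq_square)
  ultimately show ?thesis by (simp add: w_def)
qed

section \<open>Second-order expansion of the logarithm\<close>

lemma Ln_taylor_2:
  assumes "0 < y" and w: "y \<le> Im w" and z: "y \<le> Im z"
  shows "norm (Ln z - Ln w - (z - w) / w + (z - w)\<^sup>2 / (2 * w\<^sup>2)) \<le> norm (z - w) ^ 3 / y ^ 3"
proof -
  define f :: "nat \<Rightarrow> complex \<Rightarrow> complex"
    where "f i p = [Ln p, 1 / p, - 1 / p\<^sup>2, 2 / p ^ 3] ! i" for i p
  let ?H = "{p. y \<le> Im p}"
  have ne: "p \<noteq> 0" if "p \<in> ?H" for p using that \<open>0 < y\<close> by auto
  have "norm (f 0 z - (\<Sum>i\<le>2. f i w * (z - w) ^ i / fact i)) \<le> 2 / y ^ 3 * norm (z - w) ^ Suc 2 / fact 2"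
  proof (rule complex_Taylor[where S = ?H])
    show "convex ?H" by (rule convex_halfspace_Im_ge)
    fix i p assume p: "p \<in> ?H" and "i \<le> (2::nat)"
    then consider "i = 0" | "i = 1" | "i = 2" by linarith
    then show "(f i has_field_derivative f (Suc i) p) (at p within ?H)"
    proof cases
      case 1
      have "p \<notin> \<real>\<^sub>\<le>\<^sub>0" using p \<open>0 < y\<close> by (auto simp: complex_nonpos_Reals_iff)
      then show ?thesis
        unfolding f_def[abs_def] 1 by (auto intro!: derivative_eq_intros simp: inverse_eq_divide)
    next
      case 2
      then show ?thesis
        unfolding f_def[abs_def] 2 using ne[OF p]
        by (auto intro!: derivative_eq_intros simp: power2_eq_square)
    next
      case 3
      then show ?thesis
        unfolding f_def[abs_def] 3 using ne[OF p]
        by (auto intro!: derivative_eq_intros simp: field_simps power2_eq_square power3_eq_cube)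
    qed
  next
    fix p assume p: "p \<in> ?H"
    then have "y \<le> norm p" using abs_Im_le_cmod[of p] by auto
    then have "2 / norm p ^ 3 \<le> 2 / y ^ 3"
      using \<open>0 < y\<close> by (intro divide_left_mono power_mono mult_pos_pos) auto
    moreover have "f (Suc 2) p = 2 / p ^ 3" by (simp add: f_def)
    ultimately show "norm (f (Suc 2) p) \<le> 2 / y ^ 3"
      by (simp only: norm_divide norm_power norm_numeral)
  qed (use w z in auto)
  moreover have "f 0 z - (\<Sum>i\<le>2. f i w * (z - w) ^ i / fact i) =
      Ln z - Ln w - (z - w) / w + (z - w)\<^sup>2 / (2 * w\<^sup>2)"
    by (simp add: f_def numeral_2_eq_2)
  ultimately show ?thesis by (simp add: numeral_3_eq_3 numeral_2_eq_2)
qed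

text \<open>The second-order expansion of \<open>2 * Ln (Z s)\<close>. Write \<open>B\<close> for the increment of \<open>\<beta>\<close>, \<open>D\<close> for that of the
  drift \<open>\<integral> 2 / Z\<close>, \<open>\<delta> = B - D\<close> for that of \<open>Z\<close>, and \<open>w = Z u\<close>. Taylor's formula gives
  \<open>2 * \<Delta>(Ln Z) = 2 * \<delta> / w - \<delta>\<^sup>2 / w\<^sup>2 + O(\<bar>\<delta>\<bar> ^ 3)\<close>. Replacing \<open>\<delta>\<close> by \<open>B\<close> in the quadratic term and
  \<open>2 * D / w\<close> by \<open>\<integral> 4 / Z\<^sup>2\<close> costs \<open>O((v - u) powr (1 + \<alpha>))\<close>, which is \<open>O((v - u) powr (3 * \<alpha>))\<close> as
  \<open>\<alpha> \<le> 1/2\<close>. Taking real parts, what remains is the rough integrand on the left.\<close>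

lemma log_germ_estimate:
  fixes Z :: "real \<Rightarrow> complex" and \<beta> :: "real \<Rightarrow> real"
  assumes "0 \<le> t" "0 < y" and \<alpha>: "0 < \<alpha>" "\<alpha> \<le> 1/2"
    and Z_cont: "continuous_on {0..t} Z" and Im_Z: "\<And>s. s \<in> {0..t} \<Longrightarrow> y \<le> Im (Z s)"
    and Z_eq: "\<And>u v. 0 \<le> u \<Longrightarrow> u \<le> v \<Longrightarrow> v \<le> t \<Longrightarrow>
        Z v - Z u = of_real (\<beta> v - \<beta> u) - integral {u..v} (\<lambda>r. 2 / Z r)"
    and \<beta>: "hoelder_on \<alpha> {0..t} \<beta>"
  defines "\<Psi> \<equiv> \<lambda>s. 2 * ln (norm (Z s)) + integral {0..s} (\<lambda>r. Re (4 / (Z r)\<^sup>2))"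
  shows "\<exists>C. \<forall>u v. 0 \<le> u \<longrightarrow> u \<le> v \<longrightarrow> v \<le> t \<longrightarrow>
    \<bar>Re (2 / Z u) * (\<beta> v - \<beta> u) + Re (- 2 / (Z u)\<^sup>2) * (1/2 * (\<beta> v - \<beta> u)\<^sup>2) - (\<Psi> v - \<Psi> u)\<bar>
      \<le> C * (v - u) powr (3 * \<alpha>)"
proof -
  obtain C0 where C0: "0 \<le> C0" "\<And>r s. r \<in> {0..t} \<Longrightarrow> s \<in> {0..t} \<Longrightarrow> \<bar>\<beta> r - \<beta> s\<bar> \<le> C0 * \<bar>r - s\<bar> powr \<alpha>"
  proof -
    obtain C where C: "\<And>r s. r \<in> {0..t} \<Longrightarrow> s \<in> {0..t} \<Longrightarrow> \<bar>\<beta> r - \<beta> s\<bar> \<le> C * \<bar>r - s\<bar> powr \<alpha>"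
      using \<beta> unfolding hoelder_on_def by blast
    show thesis
    proof (rule that[of "\<bar>C\<bar>"])
      fix r s assume "r \<in> {0..t}" "s \<in> {0..t}"
      then show "\<bar>\<beta> r - \<beta> s\<bar> \<le> \<bar>C\<bar> * \<bar>r - s\<bar> powr \<alpha>"
        by (rule order_trans[OF C]) (auto intro: mult_right_mono)
    qed simp
  qed
  have Z_lower: "y \<le> norm (Z s)" if "s \<in> {0..t}" for s
    using Im_Z[OF that] abs_Im_le_cmod[of "Z s"] by simp
  have Z_ne: "Z s \<noteq> 0" if "s \<in> {0..t}" for s
    using Z_lower[OF that] \<open>0 < y\<close> by auto
  have cont: "continuous_on {0..t} (\<lambda>r. p / (Z r) ^ n)" for p and n :: nat
    using Z_ne by (intro continuous_intros Z_cont) auto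
  \<comment> \<open>\<open>d \<le> K1 * d powr \<alpha>\<close> and \<open>d * d powr \<alpha> \<le> K2 * d powr (3 * \<alpha>)\<close> for \<open>0 \<le> d \<le> t\<close>; \<open>A\<close> is a Hoelder
    constant of \<open>Z\<close>; the three parts of \<open>C\<close> bound the Taylor remainder, the drift and the cross term.\<close>
  define K1 where "K1 = t powr (1 - \<alpha>)"
  define K2 where "K2 = t powr (1 - 2 * \<alpha>)"
  define A where "A = C0 + 2 / y * K1"
  define C where "C = 2 * A ^ 3 / y ^ 3 + 4 * A / y ^ 3 * K2 + 2 * (C0 + A) / y ^ 3 * K2"
  have K: "0 \<le> K1" "0 \<le> K2" by (auto simp: K1_def K2_def)
  have A: "0 \<le> A" using C0(1) K(1) \<open>0 < y\<close> by (simp add: A_def)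
  have length_le: "d \<le> K1 * d powr \<alpha>" if "0 \<le> d" "d \<le> t" for d
  proof -
    have "d = d powr (1 - \<alpha>) * d powr \<alpha>" using that by (simp add: powr_add[symmetric])
    also have "\<dots> \<le> K1 * d powr \<alpha>"
      unfolding K1_def using that \<alpha> by (intro mult_right_mono powr_mono2) auto
    finally show ?thesis .
  qed
  have length_le': "d * d powr \<alpha> \<le> K2 * d powr (3 * \<alpha>)" if "0 \<le> d" "d \<le> t" for d
  proof -
    have "d * d powr \<alpha> = d powr (1 - 2 * \<alpha>) * d powr (3 * \<alpha>)"
      using that by (cases "d = 0") (simp_all add: powr_mult_base powr_add[symmetric] add.commute)
    also have "\<dots> \<le> K2 * d powr (3 * \<alpha>)"
      unfolding K2_def using that \<alpha> by (intro mult_right_mono powr_mono2) auto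
    finally show ?thesis .
  qed
  have drift: "norm (integral {u..v} (\<lambda>r. 2 / Z r)) \<le> 2 / y * (v - u)"
    if "0 \<le> u" "u \<le> v" "v \<le> t" for u v
  proof (rule integral_bound)
    show "continuous_on {u..v} (\<lambda>r. 2 / Z r)"
      using continuous_on_subset[OF cont[of 2 1], of "{u..v}"] that by auto
    show "norm (2 / Z r) \<le> 2 / y" if "r \<in> {u..v}" for r
      using that \<open>0 \<le> u\<close> \<open>v \<le> t\<close> Z_lower \<open>0 < y\<close> by (auto simp: norm_divide intro!: divide_left_mono mult_pos_pos Z_ne)
  qed (use that in auto)
  have Z_incr: "norm (Z v - Z u) \<le> A * (v - u) powr \<alpha>" if "0 \<le> u" "u \<le> v" "v \<le> t" for u v
  proof -
    have "norm (Z v - Z u) \<le> \<bar>\<beta> v - \<beta> u\<bar> + norm (integral {u..v} (\<lambda>r. 2 / Z r))"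
      unfolding Z_eq[OF that] by (metis norm_of_real norm_triangle_ineq4)
    also have "\<dots> \<le> C0 * (v - u) powr \<alpha> + 2 / y * (K1 * (v - u) powr \<alpha>)"
    proof (rule add_mono)
      show "\<bar>\<beta> v - \<beta> u\<bar> \<le> C0 * (v - u) powr \<alpha>" using C0(2)[of v u] that by simp
      have "2 / y * (v - u) \<le> 2 / y * (K1 * (v - u) powr \<alpha>)"
        using that \<open>0 < y\<close> by (intro mult_left_mono length_le) auto
      with drift[OF that] show "norm (integral {u..v} (\<lambda>r. 2 / Z r)) \<le> 2 / y * (K1 * (v - u) powr \<alpha>)"
        by linarith
    qed
    also have "\<dots> = A * (v - u) powr \<alpha>" by (simp add: A_def algebra_simps)
    finally show ?thesis .
  qed
  have main: "\<bar>Re (2 / Z u) * (\<beta> v - \<beta> u) + Re (- 2 / (Z u)\<^sup>2) * (1/2 * (\<beta> v - \<beta> u)\<^sup>2) - (\<Psi> v - \<Psi> u)\<bar>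
      \<le> C * (v - u) powr (3 * \<alpha>)" if uv: "0 \<le> u" "u \<le> v" "v \<le> t" for u v
  proof -
    define d where "d = v - u"
    define a where "a = d powr \<alpha>"
    define w where "w = Z u"
    define B where "B = complex_of_real (\<beta> v - \<beta> u)"
    define D where "D = integral {u..v} (\<lambda>r. 2 / Z r)"
    define \<delta> where "\<delta> = Z v - Z u"
    define I where "I = integral {u..v} (\<lambda>r. 4 / (Z r)\<^sup>2)"
    define R where "R = Ln (Z v) - Ln w - \<delta> / w + \<delta>\<^sup>2 / (2 * w\<^sup>2)"
    have d: "0 \<le> d" "d \<le> t" using uv by (auto simp: d_def)
    have a: "0 \<le> a" "d * a \<le> K2 * a ^ 3" "d powr (3 * \<alpha>) = a ^ 3"
    proof -
      show *: "d powr (3 * \<alpha>) = a ^ 3"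
        using d by (cases "d = 0") (simp_all add: a_def powr_realpow[symmetric] powr_powr mult.commute)
      show "d * a \<le> K2 * a ^ 3" using length_le'[OF d] * by (simp add: a_def)
    qed (simp add: a_def)
    have w: "y \<le> norm w" "w \<noteq> 0" using Z_lower[of u] Z_ne[of u] uv by (auto simp: w_def)
    have \<delta>: "\<delta> = B - D" using Z_eq[OF uv] by (simp add: \<delta>_def B_def D_def)
    have \<delta>_le: "norm \<delta> \<le> A * a" using Z_incr[OF uv] by (simp add: \<delta>_def a_def d_def)
    have B_le: "norm B \<le> C0 * a"
      using C0(2)[of v u] uv by (simp add: B_def a_def d_def del: of_real_diff)
    have D_le: "norm D \<le> 2 / y * d" using drift[OF uv] by (simp add: D_def d_def)
    have R_le: "norm R \<le> A ^ 3 / y ^ 3 * a ^ 3"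
    proof -
      have "norm R \<le> norm \<delta> ^ 3 / y ^ 3"
        unfolding R_def \<delta>_def w_def using uv by (intro Ln_taylor_2 \<open>0 < y\<close> Im_Z) auto
      also have "\<dots> \<le> (A * a) ^ 3 / y ^ 3"
        using \<delta>_le \<open>0 < y\<close> by (intro divide_right_mono power_mono) auto
      finally show ?thesis by (simp add: power_mult_distrib)
    qed
    have int: "(\<lambda>r. 2 / Z r) integrable_on {u..v}" "(\<lambda>r. 4 / (Z r)\<^sup>2) integrable_on {u..v}"
      using continuous_on_subset[OF cont[of 2 1], of "{u..v}"] continuous_on_subset[OF cont[of 4 2], of "{u..v}"] uv
      by (auto intro: integrable_continuous_real)
    have I_le: "norm (2 * D / w - I) \<le> 4 * A / y ^ 3 * K2 * a ^ 3"
    proof -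
      have "2 * D / w - I = integral {u..v} (\<lambda>r. 2 / w * (2 / Z r) - 4 / (Z r)\<^sup>2)"
      proof -
        have "((\<lambda>r. 2 / w * (2 / Z r) - 4 / (Z r)\<^sup>2) has_integral 2 / w * D - I) {u..v}"
          unfolding D_def I_def by (intro has_integral_diff has_integral_mult_right integrable_integral int)
        moreover have "2 * D / w - I = 2 / w * D - I" by simp
        ultimately show ?thesis by (simp only: integral_unique)
      qed
      also have "norm \<dots> \<le> 4 * (A * a) / y ^ 3 * (v - u)"
      proof (rule integral_bound)
        show "continuous_on {u..v} (\<lambda>r. 2 / w * (2 / Z r) - 4 / (Z r)\<^sup>2)"
          using continuous_on_subset[OF cont[of 2 1], of "{u..v}"] continuous_on_subset[OF cont[of 4 2], of "{u..v}"] uv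
          by (intro continuous_on_diff continuous_on_mult_left) auto
        show "norm (2 / w * (2 / Z r) - 4 / (Z r)\<^sup>2) \<le> 4 * (A * a) / y ^ 3"
          if r: "r \<in> {u..v}" for r
        proof -
          from r have Zr: "y \<le> norm (Z r)" "Z r \<noteq> 0" using uv Z_lower Z_ne by auto
          have "norm (Z r - w) \<le> A * (r - u) powr \<alpha>" unfolding w_def using r uv by (intro Z_incr) auto
          also have "\<dots> \<le> A * a"
            unfolding a_def d_def using r \<alpha> A by (intro mult_left_mono powr_mono2) auto
          finally have close: "norm (Z r - w) \<le> A * a" .
          have "2 / w * (2 / Z r) - 4 / (Z r)\<^sup>2 = 4 * (Z r - w) / (w * Z r * Z r)"
            using w(2) Zr(2) by (simp add: divide_simps power2_eq_square)
          also have "norm \<dots> = 4 * norm (Z r - w) / (norm w * norm (Z r) * norm (Z r))"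
            by (simp only: norm_mult norm_divide norm_numeral)
          also have "\<dots> \<le> 4 * (A * a) / (y * y * y)"
            using close w(1) Zr(1) \<open>0 < y\<close> A a(1) by (intro frac_le mult_mono mult_left_mono) auto
          finally show ?thesis
            by (simp add: power3_eq_cube)
        qed
      qed (use uv in auto)
      also have "\<dots> = 4 * A / y ^ 3 * (d * a)" by (simp add: d_def)
      also have "\<dots> \<le> 4 * A / y ^ 3 * (K2 * a ^ 3)"
        using a(2) A \<open>0 < y\<close> by (intro mult_left_mono) auto
      finally show ?thesis by simp
    qed
    have cross_le: "norm (D * (B + \<delta>) / w\<^sup>2) \<le> 2 * (C0 + A) / y ^ 3 * K2 * a ^ 3"
    proof -
      have "norm (D * (B + \<delta>) / w\<^sup>2) = norm D * norm (B + \<delta>) / (norm w * norm w)"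
        by (simp add: norm_mult norm_divide power2_eq_square)
      also have "\<dots> \<le> (2 / y * d) * (C0 * a + A * a) / (y * y)"
        using w(1) \<open>0 < y\<close> d C0(1) A a(1)
        by (intro frac_le mult_mono D_le norm_triangle_mono B_le \<delta>_le) auto
      also have "\<dots> = 2 * (C0 + A) / y ^ 3 * (d * a)"
        by (simp add: power3_eq_cube algebra_simps)
      also have "\<dots> \<le> 2 * (C0 + A) / y ^ 3 * (K2 * a ^ 3)"
        using a(2) A C0(1) \<open>0 < y\<close> by (intro mult_left_mono) auto
      finally show ?thesis by simp
    qed
    define E where "E = 2 * B / w - B\<^sup>2 / w\<^sup>2 - 2 * (Ln (Z v) - Ln w) - I"
    have E_eq: "E = - 2 * R + (2 * D / w - I) - D * (B + \<delta>) / w\<^sup>2"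
      unfolding E_def R_def \<delta> using w(2) by (simp add: field_simps power2_eq_square)
    have "norm E \<le> norm (- 2 * R + (2 * D / w - I)) + norm (D * (B + \<delta>) / w\<^sup>2)"
      unfolding E_eq by (rule norm_triangle_ineq4)
    also have "\<dots> \<le> norm (- 2 * R) + norm (2 * D / w - I) + norm (D * (B + \<delta>) / w\<^sup>2)"
      by (intro add_right_mono norm_triangle_ineq)
    also have "\<dots> \<le> 2 * (A ^ 3 / y ^ 3 * a ^ 3) + 4 * A / y ^ 3 * K2 * a ^ 3 + 2 * (C0 + A) / y ^ 3 * K2 * a ^ 3"
      using R_le I_le cross_le by (simp add: norm_mult)
    also have "\<dots> = C * a ^ 3" by (simp add: C_def algebra_simps)
    finally have "\<bar>Re E\<bar> \<le> C * d powr (3 * \<alpha>)"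
      using abs_Re_le_cmod[of E] a(3) by simp
    moreover have "Re E = Re (2 / Z u) * (\<beta> v - \<beta> u) + Re (- 2 / (Z u)\<^sup>2) * (1/2 * (\<beta> v - \<beta> u)\<^sup>2) - (\<Psi> v - \<Psi> u)"
    proof -
      have Re_scale: "Re (p * complex_of_real q) = Re p * q" for p q by simp
      have 1: "Re (2 * B / w) = Re (2 / Z u) * (\<beta> v - \<beta> u)"
        using Re_scale[of "2 / Z u" "\<beta> v - \<beta> u"] by (simp add: B_def w_def)
      have 2: "Re (B\<^sup>2 / w\<^sup>2) = - (Re (- 2 / (Z u)\<^sup>2) * (1/2 * (\<beta> v - \<beta> u)\<^sup>2))"
      proof -
        have "B\<^sup>2 / w\<^sup>2 = - ((- 2 / (Z u)\<^sup>2) * complex_of_real (1/2 * (\<beta> v - \<beta> u)\<^sup>2))"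
          by (simp add: B_def w_def)
        then show ?thesis by (simp only: Re_scale uminus_complex.sel)
      qed
      have 3: "Re (2 * (Ln (Z v) - Ln w)) = 2 * ln (norm (Z v)) - 2 * ln (norm (Z u))"
        using Z_ne[of v] w(2) uv by (simp add: w_def)
      have 4: "Re I = integral {0..v} (\<lambda>r. Re (4 / (Z r)\<^sup>2)) - integral {0..u} (\<lambda>r. Re (4 / (Z r)\<^sup>2))"
      proof -
        have "((\<lambda>r. Re (4 / (Z r)\<^sup>2)) has_integral Re I) {u..v}"
          using has_integral_linear[OF integrable_integral[OF int(2)] bounded_linear_Re]
          by (simp add: o_def I_def)
        moreover have "(\<lambda>r. Re (4 / (Z r)\<^sup>2)) integrable_on {0..v}"
          using continuous_on_subset[OF cont[of 4 2], of "{0..v}"] uv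
          by (intro integrable_continuous_real continuous_on_Re) auto
        ultimately show ?thesis
          using Henstock_Kurzweil_Integration.integral_combine[of 0 u v "\<lambda>r. Re (4 / (Z r)\<^sup>2)"] uv
          by (simp add: integral_unique)
      qed
      show ?thesis
        unfolding E_def minus_complex.sel 1 2 3 4 \<Psi>_def by simp
    qed
    ultimately show ?thesis by (simp add: d_def)
  qed
  then show ?thesis by blast
qed

section \<open>The backward flow in complex form\<close>

lemma hoelder_on_imp_continuous_on:
  assumes "hoelder_on \<alpha> S f" "0 < \<alpha>"
  shows "continuous_on S f"
  unfolding continuous_on_def
proof
  fix s assume "s \<in> S"
  obtain C where C: "\<And>r. r \<in> S \<Longrightarrow> \<bar>f r - f s\<bar> \<le> C * \<bar>r - s\<bar> powr \<alpha>"
    using assms(1) \<open>s \<in> S\<close> unfolding hoelder_on_def by blast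
  have "((\<lambda>r. f r - f s) \<longlongrightarrow> 0) (at s within S)"
  proof (rule Lim_null_comparison)
    have "((\<lambda>r. \<bar>r - s\<bar>) \<longlongrightarrow> \<bar>s - s\<bar>) (at s within S)" by (intro tendsto_intros)
    then have "((\<lambda>r. \<bar>r - s\<bar> powr \<alpha>) \<longlongrightarrow> 0) (at s within S)"
      using \<open>0 < \<alpha>\<close> by (intro tendsto_zero_powrI[where b = \<alpha>]) auto
    then show "((\<lambda>r. C * \<bar>r - s\<bar> powr \<alpha>) \<longlongrightarrow> 0) (at s within S)"
      by (rule tendsto_mult_right_zero)
    show "\<forall>\<^sub>F r in at s within S. norm (f r - f s) \<le> C * \<bar>r - s\<bar> powr \<alpha>"
      unfolding eventually_at_filter using C by (auto intro: always_eventually)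
  qed
  then show "(f \<longlongrightarrow> f s) (at s within S)" by (rule LIM_zero_cancel)
qed

lemma integral_reverse_interval:
  fixes f :: "real \<Rightarrow> 'a::euclidean_space"
  assumes "continuous_on {0..t} f"
  shows "integral {0..t} (\<lambda>r. f (t - r)) = integral {0..t} f"
proof -
  have "integral {0..t} (\<lambda>r. f (t - r)) = integral {- t..0} (\<lambda>r. f (t + r))"
    using Henstock_Kurzweil_Integration.integral_reflect_real[where a = "- t" and b = 0 and f = "\<lambda>r. f (t + r)"] by simp
  also have "(\<lambda>r. f (t + r)) = f \<circ> (\<lambda>r. r + t)" by (simp add: fun_eq_iff add.commute)
  also have "integral {- t..0} (f \<circ> (\<lambda>r. r + t)) = integral {- t + t..0 + t} f"
    by (rule integral_shift) (use assms in simp)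
  finally show ?thesis by simp
qed

text \<open>The path \<open>r \<mapsto> Z (t - r) + U r\<close> is the Loewner trajectory that ends at \<open>z + U t\<close>.\<close>

lemma loewner_inverse_deriv_backward:
  assumes "0 \<le> t" and U: "continuous_on {0..t} U" and "U 0 = 0"
    and Z_cont: "continuous_on {0..t} Z" and Im_Z: "\<And>s. s \<in> {0..t} \<Longrightarrow> 0 < Im (Z s)"
    and Z_eq: "\<And>s. s \<in> {0..t} \<Longrightarrow>
        Z s = z + of_real (U t - U (t - s)) - integral {0..s} (\<lambda>r. 2 / Z r)"
  shows "deriv (loewner_inverse U t) (z + of_real (U t)) = exp (integral {0..t} (\<lambda>r. 2 / (Z r)\<^sup>2))"
proof -
  have Z_ne: "Z s \<noteq> 0" if "s \<in> {0..t}" for s using Im_Z[OF that] by auto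
  define \<gamma> where "\<gamma> r = Z (t - r) + of_real (U r)" for r
  have \<gamma>_eq: "\<gamma> r = z + of_real (U t) - integral {0..t - r} (\<lambda>q. 2 / Z q)" if "r \<in> {0..t}" for r
    using Z_eq[of "t - r"] that by (simp add: \<gamma>_def)
  have drift_cont: "continuous_on {0..t} (\<lambda>r. 2 / Z r)"
    using Z_ne by (intro continuous_intros Z_cont) auto
  have sol: "loewner_solution U (\<gamma> 0) t \<gamma>"
    unfolding loewner_solution_def
  proof (intro conjI ballI refl)
    fix r assume r: "r \<in> {0..t}"
    then have r': "t - r \<in> {0..t}" by auto
    have Z_\<gamma>: "Z (t - r) = \<gamma> r - of_real (U r)" by (simp add: \<gamma>_def)
    then show "\<gamma> r \<noteq> of_real (U r)" using Z_ne[OF r'] by auto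
    have "(-) t ` {0..t} = {0..t}" by simp
    then have "(((\<lambda>s. integral {0..s} (\<lambda>q. 2 / Z q)) \<circ> (\<lambda>r. t - r)) has_vector_derivative
        (- 1) *\<^sub>R (2 / Z (t - r))) (at r within {0..t})"
      using integral_has_vector_derivative[OF drift_cont r']
      by (intro vector_diff_chain_within) (auto intro!: derivative_eq_intros)
    then have "((\<lambda>r. z + of_real (U t) - integral {0..t - r} (\<lambda>q. 2 / Z q)) has_vector_derivative
        0 - (- 1) *\<^sub>R (2 / Z (t - r))) (at r within {0..t})"
      unfolding o_def by (intro has_vector_derivative_diff has_vector_derivative_const)
    then have "(\<gamma> has_vector_derivative 0 - (- 1) *\<^sub>R (2 / Z (t - r))) (at r within {0..t})"
      by (rule has_vector_derivative_transform[OF r, rotated]) (simp add: \<gamma>_eq)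
    then show "(\<gamma> has_vector_derivative 2 / (\<gamma> r - of_real (U r))) (at r within {0..t})"
      by (simp add: Z_\<gamma>)
  qed
  have \<gamma>_t: "\<gamma> t = z + of_real (U t)" using \<gamma>_eq[of t] \<open>0 \<le> t\<close> by simp
  have "0 < Im (\<gamma> t)" using Im_Z[of 0] \<open>0 \<le> t\<close> by (simp add: \<gamma>_def)
  from loewner_inverse_has_field_derivative[where \<gamma> = \<gamma>, OF \<open>0 \<le> t\<close> U \<open>U 0 = 0\<close> sol this]
  have "deriv (loewner_inverse U t) (\<gamma> t) = exp (integral {0..t} (\<lambda>r. 2 / (\<gamma> r - of_real (U r))\<^sup>2))"
    by (rule DERIV_imp_deriv)
  also have "integral {0..t} (\<lambda>r. 2 / (\<gamma> r - of_real (U r))\<^sup>2) = integral {0..t} (\<lambda>r. 2 / (Z (t - r))\<^sup>2)"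
    by (simp add: \<gamma>_def)
  also have "\<dots> = integral {0..t} (\<lambda>r. 2 / (Z r)\<^sup>2)"
    using Z_ne by (intro integral_reverse_interval continuous_intros Z_cont) auto
  finally show ?thesis by (simp add: \<gamma>_t)
qed

text \<open>With \<open>Z = X + i * Y\<close> the system becomes \<open>dZ = d\<beta> - 2 / Z ds\<close>. The bound \<open>Y \<ge> y\<close> is not immediate: the
  integrand in the equation for \<open>Y\<close> has the sign of \<open>Y\<close>, so \<open>Y \<ge> y\<close> as long as \<open>Y\<close> is nonnegative, and
  this excludes a first zero of \<open>Y\<close>.\<close>

lemma backward_solution_complex:
  assumes "0 \<le> t" "0 < y" and \<beta>: "continuous_on {0..t} \<beta>"
    and sol: "backward_solution t \<beta> x y X Y"
  defines "Z \<equiv> \<lambda>s. Complex (X s) (Y s)"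
  shows "continuous_on {0..t} Z" (is ?cont)
    and "\<And>s. s \<in> {0..t} \<Longrightarrow> y \<le> Im (Z s)" (is "PROP ?Im")
    and "\<And>s. s \<in> {0..t} \<Longrightarrow>
      Z s = Complex x y + of_real (\<beta> s - \<beta> 0) - integral {0..s} (\<lambda>r. 2 / Z r)" (is "PROP ?eq")
proof -
  define p where "p r = 2 * X r / ((X r)\<^sup>2 + (Y r)\<^sup>2)" for r
  define q where "q r = 2 * Y r / ((X r)\<^sup>2 + (Y r)\<^sup>2)" for r
  have int: "p integrable_on {0..s}" "q integrable_on {0..s}"
    and X: "X s = x + (\<beta> s - \<beta> 0) - integral {0..s} p" and Y: "Y s = y + integral {0..s} q"
    if "s \<in> {0..t}" for s
    using sol that unfolding backward_solution_def p_def[abs_def] q_def[abs_def] by auto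
  have "continuous_on {0..t} (\<lambda>s. x + (\<beta> s - \<beta> 0) - integral {0..s} p)"
    using \<open>0 \<le> t\<close> by (intro continuous_intros \<beta> indefinite_integral_continuous_1 int) auto
  then have X_cont: "continuous_on {0..t} X" by (rule continuous_on_eq) (simp add: X)
  have "continuous_on {0..t} (\<lambda>s. y + integral {0..s} q)"
    using \<open>0 \<le> t\<close> by (intro continuous_intros indefinite_integral_continuous_1 int) auto
  then have Y_cont: "continuous_on {0..t} Y" by (rule continuous_on_eq) (simp add: Y)
  show ?cont unfolding Z_def Complex_eq by (intro continuous_intros X_cont Y_cont)
  have Y_ge_if: "y \<le> Y s" if s: "s \<in> {0..t}" and pos: "\<And>r. r \<in> {0..s} \<Longrightarrow> 0 \<le> Y r" for s
  proof -
    have "0 \<le> integral {0..s} q"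
      using pos by (intro integral_nonneg int s) (auto simp: q_def)
    then show ?thesis using Y[OF s] by simp
  qed
  have Y_pos: "0 < Y s" if s: "s \<in> {0..t}" for s
  proof (rule ccontr)
    assume "\<not> 0 < Y s"
    define N where "N = {r\<in>{0..s}. Y r = 0}"
    have Y0: "Y 0 = y" using Y[of 0] \<open>0 \<le> t\<close> by simp
    have Ys: "continuous_on {0..s} Y" using s by (intro continuous_on_subset[OF Y_cont]) auto
    have "compact N"
    proof -
      have "closed ({0..s} \<inter> Y -` {0})"
        by (rule continuous_closed_preimage[OF Ys]) auto
      moreover have "N = {0..s} \<inter> Y -` {0}" by (auto simp: N_def)
      ultimately show ?thesis by (auto simp: compact_eq_bounded_closed intro: bounded_subset[of "{0..s}"])
    qed
    moreover have "N \<noteq> {}"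
    proof -
      obtain r where "0 \<le> r" "r \<le> s" "Y r = 0"
        using IVT2'[of Y s 0 0] \<open>\<not> 0 < Y s\<close> Y0 \<open>0 < y\<close> s Ys by auto
      then show ?thesis by (auto simp: N_def)
    qed
    \<comment> \<open>The first zero of \<open>Y\<close>.\<close>
    ultimately obtain r where r: "r \<in> N" "\<And>r'. r' \<in> N \<Longrightarrow> r \<le> r'"
      using compact_attains_inf[of N] by auto
    have "0 \<le> Y r'" if r': "r' \<in> {0..r}" for r'
    proof (rule ccontr)
      assume neg: "\<not> 0 \<le> Y r'"
      have "continuous_on {0..r'} Y" using r(1) r' by (intro continuous_on_subset[OF Ys]) (auto simp: N_def)
      then obtain r'' where "0 \<le> r''" "r'' \<le> r'" "Y r'' = 0"
        using IVT2'[of Y r' 0 0] neg Y0 \<open>0 < y\<close> r' by auto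
      then have "r \<le> r''" using r r' by (auto simp: N_def)
      then have "r' = r" using \<open>r'' \<le> r'\<close> r' by simp
      then show False using neg r(1) by (simp add: N_def)
    qed
    then have "y \<le> Y r" using r(1) s by (intro Y_ge_if) (auto simp: N_def)
    then show False using r(1) \<open>0 < y\<close> by (simp add: N_def)
  qed
  have Y_ge: "y \<le> Y s" if s: "s \<in> {0..t}" for s
    using s by (intro Y_ge_if) (auto intro!: less_imp_le Y_pos)
  then show "PROP ?Im" by (simp add: Z_def)
  show "PROP ?eq"
  proof -
    fix s assume s: "s \<in> {0..t}"
    have parts: "Re (2 / Z r) = p r" "Im (2 / Z r) = - q r" for r
      by (simp_all add: Z_def p_def q_def Re_divide Im_divide)
    have "continuous_on {0..s} (\<lambda>r. 2 / Z r)"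
      using \<open>?cont\<close> s Y_pos
      by (intro continuous_intros continuous_on_subset[OF \<open>?cont\<close>]) (force simp: Z_def complex_eq_iff)+
    then have "((\<lambda>r. 2 / Z r) has_integral integral {0..s} (\<lambda>r. 2 / Z r)) {0..s}"
      by (intro integrable_integral integrable_continuous_real)
    from has_integral_linear[OF this bounded_linear_Re] has_integral_linear[OF this bounded_linear_Im]
    have "(p has_integral Re (integral {0..s} (\<lambda>r. 2 / Z r))) {0..s}"
      "((\<lambda>r. - q r) has_integral Im (integral {0..s} (\<lambda>r. 2 / Z r))) {0..s}"
      by (simp_all add: o_def parts)
    then have "Re (integral {0..s} (\<lambda>r. 2 / Z r)) = integral {0..s} p"
      "Im (integral {0..s} (\<lambda>r. 2 / Z r)) = - integral {0..s} q"
      by (auto dest!: integral_unique)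
    then show "Z s = Complex x y + of_real (\<beta> s - \<beta> 0) - integral {0..s} (\<lambda>r. 2 / Z r)"
      using X[OF s] Y[OF s] by (simp add: complex_eq_iff Z_def)
  qed
qed


lemma Re_two_over_square:
  fixes p :: complex
  assumes "p \<noteq> 0"
  shows "Re (2 / p\<^sup>2) = (Re (2 / p))\<^sup>2 - 2 / (norm p)\<^sup>2"
proof -
  obtain a b where p: "p = Complex a b" by (cases p)
  define q where "q = a\<^sup>2 + b\<^sup>2"
  have q: "q \<noteq> 0" using assms by (simp add: p q_def complex_eq_iff sum_power2_eq_zero_iff)
  have sq: "p\<^sup>2 = Complex (a\<^sup>2 - b\<^sup>2) (2 * a * b)"
    by (simp add: p power2_eq_square complex_eq_iff)
  have "(a\<^sup>2 - b\<^sup>2)\<^sup>2 + (2 * a * b)\<^sup>2 = q\<^sup>2"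
    by (simp add: q_def power2_eq_square algebra_simps)
  then have "Re (2 / p\<^sup>2) = 2 * (2 * a\<^sup>2 - q) / q\<^sup>2"
    by (simp add: sq Re_divide) (simp add: q_def)
  moreover have "2 * (2 * a\<^sup>2 - q) / q\<^sup>2 = (2 * a / q)\<^sup>2 - 2 / q"
    using q by (simp add: divide_simps power2_eq_square)
  moreover have "Re (2 / p) = 2 * a / q" "(norm p)\<^sup>2 = q"
    by (simp_all add: p Re_divide q_def cmod_power2)
  ultimately show ?thesis by simp
qed

text \<open>Pointwise \<open>Re (2 / p\<^sup>2) = Re (4 / p\<^sup>2) - (Re (2 / p))\<^sup>2 + 2 / \<bar>p\<bar>\<^sup>2\<close>, and the last term, taken at
  \<open>p = Z r\<close>, is the logarithmic derivative of \<open>Im Z\<close>.\<close>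

lemma log_derivative_identity:
  fixes Z :: "real \<Rightarrow> complex"
  assumes "0 \<le> t" and Z_cont: "continuous_on {0..t} Z" and Im_Z: "\<And>s. s \<in> {0..t} \<Longrightarrow> 0 < Im (Z s)"
    and Im_deriv: "\<And>s. s \<in> {0..t} \<Longrightarrow>
        ((\<lambda>r. Im (Z r)) has_vector_derivative 2 * Im (Z s) / (norm (Z s))\<^sup>2) (at s within {0..t})"
  shows "ln (norm (exp (integral {0..t} (\<lambda>r. 2 / (Z r)\<^sup>2)))) =
    integral {0..t} (\<lambda>r. Re (4 / (Z r)\<^sup>2)) - integral {0..t} (\<lambda>r. (Re (2 / Z r))\<^sup>2)
      + ln (Im (Z t) / Im (Z 0))"
proof -
  have Z_ne: "Z s \<noteq> 0" if "s \<in> {0..t}" for s using Im_Z[OF that] by auto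
  have int2: "(\<lambda>r. 2 / (Z r)\<^sup>2) integrable_on {0..t}"
    using Z_ne by (intro integrable_continuous_real continuous_intros Z_cont) auto
  have int4: "(\<lambda>r. Re (4 / (Z r)\<^sup>2)) integrable_on {0..t}"
    using Z_ne by (intro integrable_continuous_real continuous_intros Z_cont) auto
  have int_sq: "(\<lambda>r. (Re (2 / Z r))\<^sup>2) integrable_on {0..t}"
    using Z_ne by (intro integrable_continuous_real continuous_intros Z_cont) auto
  have "((\<lambda>r. 2 / (norm (Z r))\<^sup>2) has_integral ln (Im (Z t)) - ln (Im (Z 0))) {0..t}"
  proof (rule fundamental_theorem_of_calculus[OF \<open>0 \<le> t\<close>])
    fix s assume s: "s \<in> {0..t}"
    have "((\<lambda>r. Im (Z r)) has_field_derivative 2 * Im (Z s) / (norm (Z s))\<^sup>2) (at s within {0..t})"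
      using Im_deriv[OF s] by (simp add: has_real_derivative_iff_has_vector_derivative)
    from DERIV_chain2[OF DERIV_ln_divide[OF Im_Z[OF s]] this]
    show "((\<lambda>r. ln (Im (Z r))) has_vector_derivative 2 / (norm (Z s))\<^sup>2) (at s within {0..t})"
      using Im_Z[OF s] by (simp add: has_real_derivative_iff_has_vector_derivative)
  qed
  then have log_Im: "((\<lambda>r. 2 / (norm (Z r))\<^sup>2) has_integral ln (Im (Z t) / Im (Z 0))) {0..t}"
    using Im_Z[of 0] Im_Z[of t] \<open>0 \<le> t\<close> by (simp add: ln_div)
  have "ln (norm (exp (integral {0..t} (\<lambda>r. 2 / (Z r)\<^sup>2)))) = Re (integral {0..t} (\<lambda>r. 2 / (Z r)\<^sup>2))"
    by simp
  also have "\<dots> = integral {0..t} (\<lambda>r. Re (2 / (Z r)\<^sup>2))"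
    using integral_linear[OF int2 bounded_linear_Re] by (simp add: o_def)
  also have "\<dots> = integral {0..t} (\<lambda>r. Re (4 / (Z r)\<^sup>2) - (Re (2 / Z r))\<^sup>2 + 2 / (norm (Z r))\<^sup>2)"
  proof (rule integral_cong)
    fix r assume "r \<in> {0..t}"
    moreover have "Re (4 / (Z r)\<^sup>2) = 2 * Re (2 / (Z r)\<^sup>2)"
    proof -
      have "4 / (Z r)\<^sup>2 = 2 / (Z r)\<^sup>2 + 2 / (Z r)\<^sup>2" by (simp add: add_divide_distrib[symmetric])
      then show ?thesis by (simp only: plus_complex.sel mult_2)
    qed
    ultimately show "Re (2 / (Z r)\<^sup>2) = Re (4 / (Z r)\<^sup>2) - (Re (2 / Z r))\<^sup>2 + 2 / (norm (Z r))\<^sup>2"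
      using Re_two_over_square[OF Z_ne] by simp
  qed
  also have "\<dots> = integral {0..t} (\<lambda>r. Re (4 / (Z r)\<^sup>2)) - integral {0..t} (\<lambda>r. (Re (2 / Z r))\<^sup>2)
      + ln (Im (Z t) / Im (Z 0))"
    using has_integral_add[OF has_integral_diff[OF integrable_integral[OF int4] integrable_integral[OF int_sq]] log_Im]
    by (rule integral_unique)
  finally show ?thesis .
qed

section \<open>The formula for the derivative\<close>

theorem proposition1:
  fixes t \<alpha> x y :: real
    and z :: complex
    and U \<beta> X Y G dG dY dG' :: "real \<Rightarrow> real"
    and \<pi> :: "nat \<Rightarrow> real set set"
  assumes "0 \<le> t"
    and "1/3 < \<alpha>" "\<alpha> \<le> 1/2"
    and "hoelder_on \<alpha> {0..t} U" "U 0 = 0"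
    and "z = Complex x y" "0 < y"
    and "\<And>s. s \<in> {0..t} \<Longrightarrow> \<beta> s = U t - U (t - s)"
    and "backward_solution t \<beta> x y X Y"
    and "\<And>s. s \<in> {0..t} \<Longrightarrow> G s = \<beta> s - X s"
    and "\<And>s. s \<in> {0..t} \<Longrightarrow> dG s = vector_derivative G (at s within {0..t})"
    and "\<And>s. s \<in> {0..t} \<Longrightarrow> dY s = vector_derivative Y (at s within {0..t})"
    and "\<And>s. s \<in> {0..t} \<Longrightarrow> dG' s = dY s / Y s - (dG s)\<^sup>2"
    and "partition_sequence t \<pi>"
  shows
    "(\<exists>M. (\<lambda>n. \<Sum>k\<in>\<pi> n. dG (Inf k) * (\<beta> (Sup k) - \<beta> (Inf k))
              + dG' (Inf k) * (1/2 * (\<beta> (Sup k) - \<beta> (Inf k))\<^sup>2)) \<longlonglongrightarrow> M \<and>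
          ln (norm (deriv (loewner_inverse U t) (z + of_real (U t)))) =
            M - integral {0..t} (\<lambda>r. (dG r)\<^sup>2) + ln (Y t / y)
              - ln (((X t)\<^sup>2 + (Y t)\<^sup>2) / (x\<^sup>2 + y\<^sup>2)))
     \<and> (has_cont_quad_var t (reversed_partitions t \<pi>) U \<longleftrightarrow> has_cont_quad_var t \<pi> \<beta>)
     \<and> (has_cont_quad_var t \<pi> \<beta> \<longrightarrow>
          (\<exists>M\<^sub>\<pi>. (\<lambda>n. \<Sum>k\<in>\<pi> n. dG (Inf k) * (\<beta> (Sup k) - \<beta> (Inf k))) \<longlonglongrightarrow> M\<^sub>\<pi> \<and>
             ln (norm (deriv (loewner_inverse U t) (z + of_real (U t)))) =
               M\<^sub>\<pi> + 1/2 * stieltjes_integral t dG' (quad_var \<pi> \<beta>)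
                 - integral {0..t} (\<lambda>r. (dG r)\<^sup>2) + ln (Y t / y)
                 - ln (((X t)\<^sup>2 + (Y t)\<^sup>2) / (x\<^sup>2 + y\<^sup>2))))"
proof -
  note t = \<open>0 \<le> t\<close> and y = \<open>0 < y\<close> and \<beta>_def = assms(8) and sol = assms(9) and \<pi> = assms(14)
  have \<alpha>: "0 < \<alpha>" "1 < 3 * \<alpha>" using \<open>1/3 < \<alpha>\<close> by auto
  have U_cont: "continuous_on {0..t} U"
    by (rule hoelder_on_imp_continuous_on[OF \<open>hoelder_on \<alpha> {0..t} U\<close> \<alpha>(1)])
  have \<beta>_hoelder: "hoelder_on \<alpha> {0..t} \<beta>"
  proof -
    obtain C where C: "\<And>r s. r \<in> {0..t} \<Longrightarrow> s \<in> {0..t} \<Longrightarrow> \<bar>U r - U s\<bar> \<le> C * \<bar>r - s\<bar> powr \<alpha>"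
      using \<open>hoelder_on \<alpha> {0..t} U\<close> unfolding hoelder_on_def by blast
    have "\<bar>\<beta> r - \<beta> s\<bar> \<le> C * \<bar>r - s\<bar> powr \<alpha>" if "r \<in> {0..t}" "s \<in> {0..t}" for r s
      using C[of "t - s" "t - r"] that by (simp add: \<beta>_def)
    then show ?thesis unfolding hoelder_on_def by blast
  qed
  have \<beta>_cont: "continuous_on {0..t} \<beta>"
    by (rule hoelder_on_imp_continuous_on[OF \<beta>_hoelder \<alpha>(1)])
  have \<beta>0: "\<beta> 0 = 0" using \<beta>_def[of 0] t by simp
  define Z where "Z s = Complex (X s) (Y s)" for s
  note Z = backward_solution_complex[OF t y \<beta>_cont sol, folded Z_def]
  have Z_cont: "continuous_on {0..t} Z" using Z(1) by (simp add: Z_def[abs_def])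
  have Im_Z: "y \<le> Im (Z s)" if "s \<in> {0..t}" for s using Z(2)[OF that] .
  have Im_Z_pos: "0 < Im (Z s)" if "s \<in> {0..t}" for s using Im_Z[OF that] y by simp
  have Z_ne: "Z s \<noteq> 0" if "s \<in> {0..t}" for s using Im_Z_pos[OF that] by auto
  have Z_eq: "Z s = z + of_real (\<beta> s) - integral {0..s} (\<lambda>r. 2 / Z r)" if "s \<in> {0..t}" for s
    using Z(3)[OF that] \<beta>0 \<open>z = Complex x y\<close> by simp
  have Z0: "Z 0 = z" using Z_eq[of 0] \<beta>0 t by simp
  have drift_cont: "continuous_on {0..t} (\<lambda>r. 2 / Z r)"
    using Z_ne by (intro continuous_intros Z_cont) auto

  have drift_deriv: "((\<lambda>s. integral {0..s} (\<lambda>r. 2 / Z r)) has_vector_derivative 2 / Z s) (at s within {0..t})"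
    if "s \<in> {0..t}" for s
    by (rule integral_has_vector_derivative[OF drift_cont that])
  have G_deriv: "(G has_vector_derivative Re (2 / Z s)) (at s within {0..t})" if s: "s \<in> {0..t}" for s
  proof -
    have "((\<lambda>s. Re (integral {0..s} (\<lambda>r. 2 / Z r)) - x) has_vector_derivative Re (2 / Z s) - 0) (at s within {0..t})"
      by (intro has_vector_derivative_diff has_vector_derivative_const
          bounded_linear.has_vector_derivative[OF bounded_linear_Re drift_deriv[OF s]])
    then have "(G has_vector_derivative Re (2 / Z s) - 0) (at s within {0..t})"
    proof (rule has_vector_derivative_transform[OF s, rotated])
      fix r assume r: "r \<in> {0..t}"
      have "X r = Re (Z r)" by (simp add: Z_def)
      also have "\<dots> = x + \<beta> r - Re (integral {0..r} (\<lambda>r. 2 / Z r))"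
        unfolding Z_eq[OF r] by (simp add: \<open>z = Complex x y\<close>)
      finally show "G r = Re (integral {0..r} (\<lambda>r. 2 / Z r)) - x" using assms(10)[OF r] by simp
    qed
    then show ?thesis by simp
  qed
  have Y_deriv: "(Y has_vector_derivative 2 * Y s / (norm (Z s))\<^sup>2) (at s within {0..t})" if s: "s \<in> {0..t}" for s
  proof -
    have "((\<lambda>s. y - Im (integral {0..s} (\<lambda>r. 2 / Z r))) has_vector_derivative 0 - Im (2 / Z s)) (at s within {0..t})"
      by (intro has_vector_derivative_diff has_vector_derivative_const
          bounded_linear.has_vector_derivative[OF bounded_linear_Im drift_deriv[OF s]])
    then have "(Y has_vector_derivative 0 - Im (2 / Z s)) (at s within {0..t})"
    proof (rule has_vector_derivative_transform[OF s, rotated])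
      fix r assume r: "r \<in> {0..t}"
      have "Y r = Im (Z r)" by (simp add: Z_def)
      also have "\<dots> = y - Im (integral {0..r} (\<lambda>r. 2 / Z r))"
        unfolding Z_eq[OF r] by (simp add: \<open>z = Complex x y\<close>)
      finally show "Y r = y - Im (integral {0..r} (\<lambda>r. 2 / Z r))" .
    qed
    then show ?thesis by (simp add: Z_def Im_divide cmod_power2)
  qed
  \<comment> \<open>For \<open>t = 0\<close> the derivative within \<open>{0..t}\<close> is an arbitrary value; that case is treated apart, where
    all increments and integrals vanish.\<close>
  have dG_eq: "dG s = Re (2 / Z s)" if "0 < t" "s \<in> {0..t}" for s
    using assms(11)[OF that(2)] vector_derivative_within_closed_interval[OF that G_deriv[OF that(2)]] by simp
  have dG'_eq: "dG' s = Re (- 2 / (Z s)\<^sup>2)" if "0 < t" "s \<in> {0..t}" for s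
  proof -
    have "dY s = 2 * Y s / (norm (Z s))\<^sup>2"
      using assms(12)[OF that(2)] vector_derivative_within_closed_interval[OF that Y_deriv[OF that(2)]] by simp
    moreover have "Y s \<noteq> 0" using Im_Z_pos[OF that(2)] by (simp add: Z_def)
    ultimately have "dG' s = 2 / (norm (Z s))\<^sup>2 - (Re (2 / Z s))\<^sup>2"
      using assms(13)[OF that(2)] dG_eq[OF that] by simp
    then show ?thesis
      using Re_two_over_square[OF Z_ne[OF that(2)]] by (simp only: divide_minus_left uminus_complex.sel)
  qed

  \<comment> \<open>The real part of \<open>2 * Ln Z\<close> with its drift \<open>- Re (4 / Z\<^sup>2)\<close> taken out.\<close>
  define \<Psi> where "\<Psi> s = 2 * ln (norm (Z s)) + integral {0..s} (\<lambda>r. Re (4 / (Z r)\<^sup>2))" for s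
  define M where "M = \<Psi> t - \<Psi> 0"
  let ?S = "\<lambda>n. \<Sum>k\<in>\<pi> n. dG (Inf k) * (\<beta> (Sup k) - \<beta> (Inf k))
              + dG' (Inf k) * (1/2 * (\<beta> (Sup k) - \<beta> (Inf k))\<^sup>2)"
  have M_lim: "?S \<longlonglongrightarrow> M"
  proof -
    have "Z v - Z u = of_real (\<beta> v - \<beta> u) - integral {u..v} (\<lambda>r. 2 / Z r)"
      if "0 \<le> u" "u \<le> v" "v \<le> t" for u v
    proof -
      have "(\<lambda>r. 2 / Z r) integrable_on {0..v}"
        by (rule integrable_continuous_real[OF continuous_on_subset[OF drift_cont]]) (use that in auto)
      from Henstock_Kurzweil_Integration.integral_combine[OF that(1,2) this]
      have "integral {0..v} (\<lambda>r. 2 / Z r) = integral {0..u} (\<lambda>r. 2 / Z r) + integral {u..v} (\<lambda>r. 2 / Z r)"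
        by simp
      moreover have "u \<in> {0..t}" "v \<in> {0..t}" using that by auto
      ultimately show ?thesis by (simp add: Z_eq)
    qed
    from log_germ_estimate[OF t y \<alpha>(1) \<open>\<alpha> \<le> 1/2\<close> Z_cont Im_Z this \<beta>_hoelder]
    obtain C where C: "\<And>u v. 0 \<le> u \<Longrightarrow> u \<le> v \<Longrightarrow> v \<le> t \<Longrightarrow>
      \<bar>Re (2 / Z u) * (\<beta> v - \<beta> u) + Re (- 2 / (Z u)\<^sup>2) * (1/2 * (\<beta> v - \<beta> u)\<^sup>2) - (\<Psi> v - \<Psi> u)\<bar>
        \<le> C * (v - u) powr (3 * \<alpha>)"
      unfolding \<Psi>_def by blast
    have "(\<lambda>n. \<Sum>k\<in>\<pi> n. Re (2 / Z (Inf k)) * (\<beta> (Sup k) - \<beta> (Inf k))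
              + Re (- 2 / (Z (Inf k))\<^sup>2) * (1/2 * (\<beta> (Sup k) - \<beta> (Inf k))\<^sup>2)) \<longlonglongrightarrow> M"
      unfolding M_def by (rule sum_germ_tendsto_increment[OF \<pi> t \<alpha>(2) C])
    moreover have "?S n = (\<Sum>k\<in>\<pi> n. Re (2 / Z (Inf k)) * (\<beta> (Sup k) - \<beta> (Inf k))
              + Re (- 2 / (Z (Inf k))\<^sup>2) * (1/2 * (\<beta> (Sup k) - \<beta> (Inf k))\<^sup>2))" for n
    proof (rule sum.cong)
      fix k assume k: "k \<in> \<pi> n"
      note K = division_of_interval_bounds[OF partition_sequenceD(1)[OF \<pi>] k]
      show "dG (Inf k) * (\<beta> (Sup k) - \<beta> (Inf k)) + dG' (Inf k) * (1/2 * (\<beta> (Sup k) - \<beta> (Inf k))\<^sup>2) =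
        Re (2 / Z (Inf k)) * (\<beta> (Sup k) - \<beta> (Inf k))
              + Re (- 2 / (Z (Inf k))\<^sup>2) * (1/2 * (\<beta> (Sup k) - \<beta> (Inf k))\<^sup>2)"
      proof (cases "t = 0")
        case True
        then have "Sup k = 0" "Inf k = 0" using K by auto
        then show ?thesis by (simp only: diff_self mult_zero_right power_zero_numeral)
      next
        case False
        then have "0 < t" "Inf k \<in> {0..t}" using t K by auto
        then show ?thesis by (simp only: dG_eq dG'_eq)
      qed
    qed simp
    ultimately show ?thesis by (simp only:)
  qed

  have dG_int: "integral {0..t} (\<lambda>r. (dG r)\<^sup>2) = integral {0..t} (\<lambda>r. (Re (2 / Z r))\<^sup>2)"
  proof (cases "t = 0")
    case False
    then show ?thesis using t by (intro integral_cong) (simp add: dG_eq)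
  qed simp
  have formula: "ln (norm (deriv (loewner_inverse U t) (z + of_real (U t)))) =
      M - integral {0..t} (\<lambda>r. (dG r)\<^sup>2) + ln (Y t / y) - ln (((X t)\<^sup>2 + (Y t)\<^sup>2) / (x\<^sup>2 + y\<^sup>2))"
  proof -
    have "deriv (loewner_inverse U t) (z + of_real (U t)) = exp (integral {0..t} (\<lambda>r. 2 / (Z r)\<^sup>2))"
      by (rule loewner_inverse_deriv_backward[OF t U_cont \<open>U 0 = 0\<close> Z_cont Im_Z_pos])
         (use Z_eq \<beta>_def in auto)
    moreover have "ln (norm (exp (integral {0..t} (\<lambda>r. 2 / (Z r)\<^sup>2)))) =
        integral {0..t} (\<lambda>r. Re (4 / (Z r)\<^sup>2)) - integral {0..t} (\<lambda>r. (Re (2 / Z r))\<^sup>2)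
        + ln (Im (Z t) / Im (Z 0))"
      by (rule log_derivative_identity[OF t Z_cont Im_Z_pos]) (use Y_deriv in \<open>auto simp: Z_def\<close>)
    moreover have "ln (((X t)\<^sup>2 + (Y t)\<^sup>2) / (x\<^sup>2 + y\<^sup>2)) = 2 * ln (norm (Z t)) - 2 * ln (norm (Z 0))"
    proof -
      have "(X t)\<^sup>2 + (Y t)\<^sup>2 = (norm (Z t))\<^sup>2" "x\<^sup>2 + y\<^sup>2 = (norm (Z 0))\<^sup>2"
        by (simp_all add: Z0 \<open>z = Complex x y\<close> cmod_power2) (simp add: Z_def cmod_power2)
      then show ?thesis using Z_ne[of t] Z_ne[of 0] t by (simp add: ln_div ln_realpow)
    qed
    moreover have "Im (Z t) = Y t" "Im (Z 0) = y" by (simp_all add: Z0 \<open>z = Complex x y\<close>) (simp add: Z_def)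
    ultimately show ?thesis by (simp add: M_def \<Psi>_def dG_int)
  qed

  have dG'_cont: "continuous_on {0..t} dG'"
  proof (cases "t = 0")
    case False
    have "continuous_on {0..t} (\<lambda>s. Re (- 2 / (Z s)\<^sup>2))"
      using Z_ne by (intro continuous_intros Z_cont) auto
    then show ?thesis
      by (rule continuous_on_eq) (use False t in \<open>simp add: dG'_eq\<close>)
  qed simp
  have Foellmer: "\<exists>M\<^sub>\<pi>. (\<lambda>n. \<Sum>k\<in>\<pi> n. dG (Inf k) * (\<beta> (Sup k) - \<beta> (Inf k))) \<longlonglongrightarrow> M\<^sub>\<pi> \<and>
      ln (norm (deriv (loewner_inverse U t) (z + of_real (U t)))) =
        M\<^sub>\<pi> + 1/2 * stieltjes_integral t dG' (quad_var \<pi> \<beta>)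
          - integral {0..t} (\<lambda>r. (dG r)\<^sup>2) + ln (Y t / y)
          - ln (((X t)\<^sup>2 + (Y t)\<^sup>2) / (x\<^sup>2 + y\<^sup>2))" if qv: "has_cont_quad_var t \<pi> \<beta>"
  proof (intro exI conjI)
    let ?J = "stieltjes_integral t dG' (quad_var \<pi> \<beta>)"
    \<comment> \<open>The second-order terms converge by themselves, hence so do the first-order terms.\<close>
    have "(\<lambda>n. ?S n - 1/2 * weighted_sq_sum dG' \<beta> 0 t (\<pi> n)) \<longlonglongrightarrow> M - 1/2 * ?J"
      by (intro tendsto_diff tendsto_mult tendsto_const M_lim
          weighted_sq_sum_tendsto_integral[OF \<pi> t \<beta>_cont dG'_cont qv])
    moreover have "?S n - 1/2 * weighted_sq_sum dG' \<beta> 0 t (\<pi> n) =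
        (\<Sum>k\<in>\<pi> n. dG (Inf k) * (\<beta> (Sup k) - \<beta> (Inf k)))" for n
      unfolding weighted_sq_sum_full[OF partition_sequenceD(1)[OF \<pi>]] sum_distrib_left sum_subtractf[symmetric]
      by (rule sum.cong) simp_all
    ultimately show "(\<lambda>n. \<Sum>k\<in>\<pi> n. dG (Inf k) * (\<beta> (Sup k) - \<beta> (Inf k))) \<longlonglongrightarrow> M - 1/2 * ?J"
      by (simp only:)
    show "ln (norm (deriv (loewner_inverse U t) (z + of_real (U t)))) =
        M - 1/2 * ?J + 1/2 * ?J - integral {0..t} (\<lambda>r. (dG r)\<^sup>2) + ln (Y t / y)
          - ln (((X t)\<^sup>2 + (Y t)\<^sup>2) / (x\<^sup>2 + y\<^sup>2))"
      unfolding formula by simp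
  qed
  show ?thesis
    using M_lim formula has_cont_quad_var_reversal[OF \<pi> t U_cont \<beta>_def] Foellmer by blast
qed

end
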